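(* Consider the equation $$\ddot x+\eta(\dot x-\nu)+\varepsilon f_x(x,t)=0,\qquad f(x,t)=-\frac{1}{2\rho_e(t)^3}\cos\big(2x-2\mathrm f_e(t)\big),$$ where $e$ is the eccentricity and $\rho_e,\mathrm f_e$ are the orbital radius and true anomaly defined in the context. (Moons) For each of the following eighteen triples $(e,\varepsilon,\nu)$ and every real $\eta$ with $0\le\eta\le 0.008$, the equation admits a $1{:}1$ spin--orbit resonance, i.e. a solution $x:\mathbb R\to\mathbb R$ with $x(t+2\pi)=x(t)+2\pi$ for all $t\in\mathbb R$: Moon: $(0.0549,\ 0.00248454179,\ 1.018088056)$; Io: $(0.0041,\ 0.00863266715,\ 1.00010086)$; Europa: $(0.0094,\ 0.00096104552,\ 1.000530163)$; Ganymede: $(0.0011,\ 0.0019382783,\ 1.00000726)$; Callisto: $(0.0074,\ 0.00186698679,\ 1.000328561)$; Mimas: $(0.0193,\ 0.08966019091,\ 1.002234993)$; Enceladus: $(0.0047,\ 0.03540026218,\ 1.00013254)$; Tethys: $(0.0001,\ 0.03293212897,\ 1.00000006)$; Dione: $(0.0022,\ 0.00853478156,\ 1.00002904)$; Rhea: $(0.001,\ 0.0098127957,\ 1.000006)$; Titan: $(0.0288,\ 0.00017882901,\ 1.00497691)$; Iapetus: $(0.0283,\ 0.011662022156,\ 1.004805592)$; Ariel: $(0.0012,\ 0.012162311957,\ 1.00000864)$; Umbriel: $(0.0039,\ 0.01436601227,\ 1.00009126)$; Titania: $(0.0011,\ 0.00684493838,\ 1.00000726)$; Oberon: $(0.0014,\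 0.01024416739,\ 1.00001176)$; Miranda: $(0.0013,\ 0.04869051956,\ 1.00001014)$; Charon: $(0.0022,\ 0.00695821306,\ 1.00002904)$. (Mercury) For $(e,\varepsilon,\nu)=(0.2056,\ 0.00061470369,\ 1.255835458)$ and every real $\eta$ with $0\le\eta\le 0.001$, the equation admits a $3{:}2$ spin--orbit resonance, i.e. a solution $x:\mathbb R\to\mathbb R$ with $x(t+4\pi)=x(t)+6\pi$ for all $t\in\mathbb R$.
   Context: For $0\le e<1$ and $t\in\mathbb R$, the eccentric anomaly $u_e(t)\in\mathbb R$ is the unique solution $u$ of the Kepler equation $t=u-e\sin u$. The (normalized) orbital radius is $\rho_e(t)=1-e\cos(u_e(t))$. The true anomaly is $\mathrm f_e(t)=2\arctan\Big(\sqrt{\tfrac{1+e}{1-e}}\tan\big(\tfrac{u_e(t)}{2}\big)\Big)$, understood as an angle mod $2\pi$ extended continuously through $u_e(t)\equiv\pi \pmod{2\pi}$ (where its value is $\pi$). Equivalently, $\mathrm f_e(t)$ is the polar angle, seen from the focus, of the point at eccentric anomaly $u_e(t)$ on the ellipse. A subscript $x$ denotes the partial derivative in $x$, and dots denote $t$-derivatives. For co-prime nonzero integers $p,q$, a $p{:}q$ spin--orbit resonance is a solution $x:\mathbb R\to\mathbb R$ of the equation with $x(t+2\pi q)=x(t)+2\pi p$ for all $t$. Physically, $\varepsilon=\frac32\frac{a^2-b^2}{a^2+b^2}$ is the oblateness ($a\ge b$ being the equatorial axes), $\eta=K\Omega_e$ with a constant $K\ge0$, and $\nu=\nu_e=N_e/\Omega_e$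 with $\Omega_e=(1+3e^2+\frac38e^4)(1-e^2)^{-9/2}$ and $N_e=(1+\frac{15}{2}e^2+\frac{45}{8}e^4+\frac{5}{16}e^6)(1-e^2)^{-6}$. The values of $\varepsilon$ and $\nu$ listed in the claim are the tabulated decimal values of these quantities, and the claim is about the listed numbers. *)

theory Defs
  imports "HOL-Analysis.Analysis"
begin

definition ecc_anomaly :: "real \<Rightarrow> real \<Rightarrow> real" where
  "ecc_anomaly e t = (THE u. t = u - e * sin u)"

lemma kepler_ex1:
  fixes e t :: real
  assumes "0 \<le> e" "e < 1"
  shows "\<exists>!u. t = u - e * sin u"
proof -
  let ?g = "\<lambda>u::real. u - e * sin u"
  have sm: "?g a < ?g b" if "a < b" for a b
  proof (rule DERIV_pos_imp_increasing[OF that])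
    fix u :: real
    have "e * cos u \<le> e * 1"
      using assms by (intro mult_left_mono) auto
    then have "1 - e * cos u > 0" using assms by linarith
    moreover have "(?g has_real_derivative 1 - e * cos u) (at u)"
      by (auto intro!: derivative_eq_intros)
    ultimately show "\<exists>y. (?g has_real_derivative y) (at u) \<and> y > 0" by blast
  qed
  have b: "\<bar>e * sin u\<bar> \<le> 1" for u :: real
    using assms abs_sin_le_one[of u] by (simp add: abs_mult mult_le_one)
  have "?g (t - 1) \<le> t" using b[of "t - 1"] by linarith
  moreover have "t \<le> ?g (t + 1)" using b[of "t + 1"] by linarith
  ultimately have "\<exists>u. t - 1 \<le> u \<and> u \<le> t + 1 \<and> ?g u = t"
    by (intro IVT') (auto intro!: continuous_intros)
  then obtain u where u: "?g u = t" by blast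
  show ?thesis
  proof (rule ex1I[of _ u])
    show "t = ?g u" using u by simp
    fix w assume "t = ?g w"
    with u show "w = u" using sm[of u w] sm[of w u] by force
  qed
qed

definition orbital_radius :: "real \<Rightarrow> real \<Rightarrow> real" where
  "orbital_radius e t = 1 - e * cos (ecc_anomaly e t)"

(* The angle is represented by its value in the interval from -pi (excluded) to pi (included).
   The library sets tan to 0 at its poles, so the value pi there has to be given separately. *)
definition true_anomaly :: "real \<Rightarrow> real \<Rightarrow> real" where
  "true_anomaly e t =
     (if cos (ecc_anomaly e t / 2) = 0 then pi
      else 2 * arctan (sqrt ((1 + e) / (1 - e)) * tan (ecc_anomaly e t / 2)))"

(* The true anomaly is the polar angle, seen from the focus, of the point with eccentric
   anomaly u on the ellipse. *)
lemma true_anomaly_polar: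
  fixes e t :: real
  assumes "0 \<le> e" "e < 1"
  shows "orbital_radius e t * cos (true_anomaly e t) = cos (ecc_anomaly e t) - e"
    and "orbital_radius e t * sin (true_anomaly e t) = sqrt (1 - e\<^sup>2) * sin (ecc_anomaly e t)"
proof -
  define h where "h = ecc_anomaly e t / 2"
  have u: "ecc_anomaly e t = 2 * h" by (simp add: h_def)
  define k where "k = sqrt ((1 + e) / (1 - e))"
  have k2: "k\<^sup>2 = (1 + e) / (1 - e)" using assms by (simp add: k_def)
  have k2': "(1 - e) * k\<^sup>2 = 1 + e" using assms by (simp add: k2)
  have sq: "sqrt (1 - e\<^sup>2) = (1 - e) * k"
  proof (rule real_sqrt_unique)
    have "((1 - e) * k)\<^sup>2 = (1 - e) * ((1 - e) * k\<^sup>2)" by (simp add: power2_eq_square)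
    also have "\<dots> = 1 - e\<^sup>2" unfolding k2' by (simp add: power2_eq_square algebra_simps)
    finally show "((1 - e) * k)\<^sup>2 = 1 - e\<^sup>2" .
    show "0 \<le> (1 - e) * k" using assms by (simp add: k_def)
  qed
  have "orbital_radius e t * cos (true_anomaly e t) = cos (2 * h) - e \<and>
        orbital_radius e t * sin (true_anomaly e t) = (1 - e) * k * sin (2 * h)"
  proof (cases "cos h = 0")
    case True
    then have "cos (2 * h) = -1" by (simp add: cos_double_cos)
    then show ?thesis using True
      by (simp add: orbital_radius_def true_anomaly_def u sin_double)
  next
    case False
    define a where "a = arctan (k * tan h)"
    have ta: "true_anomaly e t = 2 * a" using False by (simp add: true_anomaly_def u a_def k_def)
    have ca: "cos a \<noteq> 0" by (simp add: a_def)
    have "tan a = k * tan h" by (simp only: a_def tan_arctan)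
    then have sa: "sin a * cos h = k * sin h * cos a"
      using ca False by (simp add: tan_def field_simps)
    define s where "s = sin h"
    define c where "c = cos h"
    define A where "A = cos a"
    define B where "B = sin a"
    have sc: "s\<^sup>2 = 1 - c\<^sup>2" by (simp add: s_def c_def sin_squared_eq)
    have AB: "B\<^sup>2 = 1 - A\<^sup>2" by (simp add: A_def B_def sin_squared_eq)
    have c0: "c \<noteq> 0" using False by (simp add: c_def)
    have sa': "B * c = k * s * A" using sa by (simp add: s_def c_def A_def B_def)
    have r: "orbital_radius e t = 1 - e * (2 * c\<^sup>2 - 1)"
      by (simp add: orbital_radius_def u cos_double_cos c_def)
    have "(1 - e) * (B\<^sup>2 * c\<^sup>2) = (1 + e) * s\<^sup>2 * A\<^sup>2"
      using arg_cong[OF sa', of "\<lambda>z. (1 - e) * z\<^sup>2"] k2'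
      by (simp add: power_mult_distrib mult.assoc[symmetric])
    then have rA: "(1 - e * (2 * c\<^sup>2 - 1)) * A\<^sup>2 = (1 - e) * c\<^sup>2"
      unfolding sc AB by (simp add: algebra_simps)
    have C: "(1 - e * (2 * c\<^sup>2 - 1)) * (2 * A\<^sup>2 - 1) = (2 * c\<^sup>2 - 1) - e"
      using rA by (simp add: algebra_simps)
    have "c * ((1 - e * (2 * c\<^sup>2 - 1)) * (2 * B * A)) = 2 * k * s * ((1 - e * (2 * c\<^sup>2 - 1)) * A\<^sup>2)"
      using sa' by algebra
    also have "\<dots> = c * ((1 - e) * k * (2 * s * c))" unfolding rA by (simp add: power2_eq_square)
    finally have S: "(1 - e * (2 * c\<^sup>2 - 1)) * (2 * B * A) = (1 - e) * k * (2 * s * c)"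
      using c0 by simp
    show ?thesis using C S unfolding r ta
      by (simp add: cos_double_cos sin_double A_def B_def c_def s_def)
  qed
  then show "orbital_radius e t * cos (true_anomaly e t) = cos (ecc_anomaly e t) - e"
    and "orbital_radius e t * sin (true_anomaly e t) = sqrt (1 - e\<^sup>2) * sin (ecc_anomaly e t)"
    unfolding u sq by auto
qed

definition spin_orbit_potential :: "real \<Rightarrow> real \<Rightarrow> real \<Rightarrow> real" where
  "spin_orbit_potential e x t =
     - (1 / (2 * orbital_radius e t ^ 3)) * cos (2 * x - 2 * true_anomaly e t)"

definition spin_orbit_solution ::
  "real \<Rightarrow> real \<Rightarrow> real \<Rightarrow> real \<Rightarrow> (real \<Rightarrow> real) \<Rightarrow> bool" where
  "spin_orbit_solution e \<epsilon> \<nu> \<eta> x \<longleftrightarrow>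
     (\<exists>x' x''. \<forall>t.
        (x has_real_derivative x' t) (at t) \<and>
        (x' has_real_derivative x'' t) (at t) \<and>
        x'' t + \<eta> * (x' t - \<nu>) + \<epsilon> * deriv (\<lambda>y. spin_orbit_potential e y t) (x t) = 0)"

definition spin_orbit_resonance ::
  "int \<Rightarrow> int \<Rightarrow> real \<Rightarrow> real \<Rightarrow> real \<Rightarrow> real \<Rightarrow> (real \<Rightarrow> real) \<Rightarrow> bool" where
  "spin_orbit_resonance p q e \<epsilon> \<nu> \<eta> x \<longleftrightarrow>
     p \<noteq> 0 \<and> q \<noteq> 0 \<and> coprime p q \<and>
     spin_orbit_solution e \<epsilon> \<nu> \<eta> x \<and>
     (\<forall>t. x (t + 2 * pi * of_int q) = x t + 2 * pi * of_int p)"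

end

theory Submission
  imports Defs
begin

text \<open>
Writing \<open>x t = v t + (p / q) t\<close>, a resonance is a periodic solution \<open>v\<close>, of period \<open>T = 2 pi q\<close>, of
\<open>v'' + \<eta> v' + \<eta> (p / q - \<nu>) + \<epsilon> F t v = 0\<close>, where \<open>F\<close> is the bounded force
\<open>sin (2 v + 2 (p / q) t - 2 f) / \<rho>\<^sup>3\<close> and \<open>f\<close> is the true anomaly. The existence proof is a Lyapunov-Schmidt
reduction. Integrating twice and discarding the mean each time gives, for every prescribed initial
value \<open>\<xi>\<close>, a fixed point problem which is a contraction because \<open>\<epsilon>\<close> and \<open>\<eta>\<close> are small. The estimate
that an oscillation shrinks by \<open>T / 4\<close> under integration (\<open>periodic_oscillation_bound\<close>) is sharp enough
for all listed bodies. The fixed point \<open>v\<close> depends continuously on \<open>\<xi>\<close>, deviates little from \<open>\<xi>\<close>, and is a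
genuine solution if the average of \<open>\<eta> (p / q - \<nu>) + \<epsilon> F t (v t)\<close> vanishes. By the intermediate value
theorem it is enough that this average has opposite signs at \<open>\<xi> = - pi / 4\<close> and \<open>\<xi> = pi / 4\<close>
(\<open>periodic_solution\<close>, \<open>resonance_criterion\<close>).

For the moons the orbit is nearly circular, \<open>f\<close> is close to \<open>t\<close>, and the force itself has a sign near
\<open>\<plusminus> pi / 4\<close> which dominates the drift \<open>\<eta> (1 - \<nu>)\<close> (\<open>synchronous_resonance\<close>). The eighteen cases are
numerical instances.

For Mercury the average of \<open>cos (3 t - 2 f) / \<rho>\<^sup>3\<close> has to be bounded from below by a genuine integral
estimate. In the true anomaly the integrand becomes a multiple of \<open>(1 + e cos f) cos (phase f)\<close>, and the
phase \<open>3 t - 2 f\<close> is a convex function of \<open>f\<close> on \<open>{0..pi}\<close>; replacing it by a broken line gives an explicit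
integral (\<open>phase_weight_integral\<close>) that is large enough (\<open>mercury_resonance\<close>). All integrals appear as
increments of primitives that are compared through their derivatives.
\<close>

section \<open>Primitives and oscillation of periodic functions\<close>

lemma DERIV_diff_le:
  fixes f g :: "real \<Rightarrow> real"
  assumes "a \<le> b"
    and "\<And>x. a \<le> x \<Longrightarrow> x \<le> b \<Longrightarrow> (f has_real_derivative f' x) (at x)"
    and "\<And>x. a \<le> x \<Longrightarrow> x \<le> b \<Longrightarrow> (g has_real_derivative g' x) (at x)"
    and "\<And>x. a \<le> x \<Longrightarrow> x \<le> b \<Longrightarrow> f' x \<le> g' x"
  shows "f b - f a \<le> g b - g a"
proof -
  have "g a - f a \<le> g b - f b"
  proof (rule DERIV_nonneg_imp_nondecreasing[OF assms(1)])
    fix x assume x: "a \<le> x" "x \<le> b"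
    show "\<exists>y. ((\<lambda>x. g x - f x) has_real_derivative y) (at x) \<and> 0 \<le> y"
      using assms(4)[OF x] by (intro exI[of _ "g' x - f' x"] conjI DERIV_diff assms x) auto
  qed
  then show ?thesis by simp
qed

lemma DERIV_growth_ge:
  fixes G :: "real \<Rightarrow> real"
  assumes "a \<le> b" "\<And>t. (G has_real_derivative g t) (at t)" "\<And>t. m \<le> g t"
  shows "m * (b - a) \<le> G b - G a"
proof -
  have "m * b - m * a \<le> G b - G a"
    by (rule DERIV_diff_le[OF assms(1) _ assms(2) assms(3)]) (auto intro!: derivative_eq_intros)
  then show ?thesis by (simp add: algebra_simps)
qed

lemma int_periodic:
  fixes P :: "real \<Rightarrow> 'a"
  assumes "\<And>t. P (t + T) = P t"
  shows "P (t + of_int n * T) = P t"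
proof (induction n arbitrary: t rule: int_induct[where k = 0])
  case (step1 i)
  have "P (t + of_int (i + 1) * T) = P ((t + of_int i * T) + T)" by (simp add: algebra_simps)
  with step1 assms show ?case by simp
next
  case (step2 i)
  have "P (t + of_int (i - 1) * T) = P ((t + of_int (i - 1) * T) + T)" by (simp add: assms)
  also have "(t + of_int (i - 1) * T) + T = t + of_int i * T" by (simp add: algebra_simps)
  finally show ?case using step2 by simp
qed simp

lemma periodic_shift_into:
  fixes P :: "real \<Rightarrow> 'a"
  assumes "T > 0" "\<And>t. P (t + T) = P t"
  obtains r where "s \<le> r" "r < s + T" "P r = P t"
proof
  define n where "n = \<lfloor>(t - s) / T\<rfloor>"
  have "of_int n \<le> (t - s) / T" "(t - s) / T < of_int n + 1" by (auto simp: n_def)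
  with \<open>T > 0\<close> show "s \<le> t + of_int (- n) * T" "t + of_int (- n) * T < s + T"
    by (auto simp: field_simps)
  show "P (t + of_int (- n) * T) = P t" using assms(2) by (rule int_periodic)
qed

text \<open>
The increment of the periodic function \<open>P\<close> over a part \<open>a\<close> of the period is the opposite of its
increment over the remaining part \<open>b\<close>. By the mean value theorem they are \<open>a * q1\<close> and \<open>b * q2\<close>
with values \<open>q1\<close>, \<open>q2\<close> of the derivative, so that the increment equals
\<open>a * b / T * (q1 - q2)\<close>, and \<open>a * b \<le> T\<^sup>2 / 4\<close>. Estimating the oscillation instead of the
supremum makes additive constants irrelevant and gives the factor \<open>T / 4\<close>; a factor
\<open>T / 2\<close> would be too weak for Mimas, where the contraction constant, which contains two
integrations, is already about 0.96.
\<close>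
lemma periodic_oscillation_bound:
  fixes P Q :: "real \<Rightarrow> real"
  assumes T: "T > 0" and per: "\<And>t. P (t + T) = P t"
    and der: "\<And>t. (P has_real_derivative Q t) (at t)"
    and osc: "\<And>s t. \<bar>Q s - Q t\<bar> \<le> K"
  shows "\<bar>P s - P t\<bar> \<le> K * T / 4"
proof -
  obtain r where r: "s \<le> r" "r < s + T" "P r = P t"
    using periodic_shift_into[of T P s t] T per by blast
  have K: "0 \<le> K" using osc[of 0 0] by simp
  show ?thesis
  proof (cases "r = s")
    case True
    then show ?thesis using r K T by simp
  next
    case False
    define a b where "a = r - s" and "b = s + T - r"
    have ab: "a > 0" "b > 0" "a + b = T" using r False by (auto simp: a_def b_def)
    obtain z1 where z1: "P r - P s = a * Q z1"
      using MVT2[of s r P Q] der r False unfolding a_def by force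
    obtain z2 where z2: "P (s + T) - P r = b * Q z2"
      using MVT2[of r "s + T" P Q] der r unfolding b_def by force
    have z2': "P s - P r = b * Q z2" using z2 per by simp
    have "T * (P r - P s) = a * b * (Q z1 - Q z2)"
      using z1 z2' unfolding ab(3)[symmetric] by algebra
    then have "T * \<bar>P s - P t\<bar> = a * b * \<bar>Q z1 - Q z2\<bar>"
      using ab T unfolding r(3)[symmetric] by (metis abs_minus_commute abs_mult abs_of_pos mult_pos_pos)
    also have "\<dots> \<le> a * b * K" using ab osc by (intro mult_left_mono) auto
    also have "\<dots> \<le> T\<^sup>2 / 4 * K"
    proof (intro mult_right_mono K)
      have "0 \<le> (a - b)\<^sup>2" by simp
      then show "a * b \<le> T\<^sup>2 / 4" unfolding ab(3)[symmetric] by (simp add: power2_eq_square algebra_simps)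
    qed
    finally have "T * \<bar>P s - P t\<bar> \<le> T * (K * T / 4)" by (simp add: power2_eq_square algebra_simps)
    then show ?thesis using T by (simp only: mult_le_cancel_left_pos)
  qed
qed

definition prim :: "(real \<Rightarrow> real) \<Rightarrow> real \<Rightarrow> real" where
  "prim g = (SOME P. P 0 = 0 \<and> (\<forall>t. (P has_real_derivative g t) (at t)))"

lemma
  assumes "continuous_on UNIV g"
  shows prim_0: "prim g 0 = 0"
    and prim_deriv: "(prim g has_real_derivative g t) (at t)"
proof -
  have "\<exists>P. \<forall>x::real. -\<infinity> < ereal x \<longrightarrow> ereal x < \<infinity> \<longrightarrow> (P has_vector_derivative g x) (at x)"
    by (rule einterval_antiderivative) (use assms in \<open>auto simp: continuous_on_eq_continuous_at\<close>)
  then obtain P where P: "\<And>x. (P has_real_derivative g x) (at x)"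
    by (auto simp: has_real_derivative_iff_has_vector_derivative)
  have "\<exists>P. P 0 = 0 \<and> (\<forall>t. (P has_real_derivative g t) (at t))"
    by (rule exI[of _ "\<lambda>t. P t - P 0"]) (auto intro!: derivative_eq_intros P)
  from someI_ex[OF this] show "prim g 0 = 0" "(prim g has_real_derivative g t) (at t)"
    unfolding prim_def by blast+
qed

lemma diff_eq_of_derivs_eq:
  fixes P R :: "real \<Rightarrow> real"
  assumes "\<And>t. (P has_real_derivative g t) (at t)" "\<And>t. (R has_real_derivative g t) (at t)"
  shows "P t - P s = R t - R s"
proof -
  have "\<forall>x. ((\<lambda>t. P t - R t) has_real_derivative 0) (at x)"
    by (auto intro!: derivative_eq_intros assms)
  then have "P t - R t = P s - R s" by (rule DERIV_isconst_all)
  then show ?thesis by simp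
qed

text \<open>
For a \<open>T\<close>-periodic \<open>g\<close> this solves \<open>P' = g - mean g\<close>, \<open>P 0 = 0\<close>; subtracting the mean is what
makes the primitive periodic.
\<close>
definition mean_free_prim :: "real \<Rightarrow> (real \<Rightarrow> real) \<Rightarrow> real \<Rightarrow> real" where
  "mean_free_prim T g = prim (\<lambda>t. g t - prim g T / T)"

lemma
  assumes g: "continuous_on UNIV g"
  shows mean_free_prim_0: "mean_free_prim T g 0 = 0"
    and mean_free_prim_deriv: "(mean_free_prim T g has_real_derivative g t - prim g T / T) (at t)"
    and mean_free_prim_continuous: "continuous_on UNIV (mean_free_prim T g)"
proof -
  have c: "continuous_on UNIV (\<lambda>t. g t - prim g T / T)" by (intro continuous_intros g)
  show "mean_free_prim T g 0 = 0" unfolding mean_free_prim_def by (rule prim_0[OF c])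
  show d: "(mean_free_prim T g has_real_derivative g t - prim g T / T) (at t)" for t
    unfolding mean_free_prim_def by (rule prim_deriv[OF c])
  show "continuous_on UNIV (mean_free_prim T g)"
    using d DERIV_isCont by (fastforce simp: continuous_on_eq_continuous_at)
qed

lemma mean_free_prim_periodic:
  assumes T: "T > 0" and g: "continuous_on UNIV g" and per: "\<And>t. g (t + T) = g t"
  shows "mean_free_prim T g (t + T) = mean_free_prim T g t"
proof -
  note d = mean_free_prim_deriv[OF g]
  have s: "((\<lambda>s. mean_free_prim T g (s + T)) has_real_derivative g s - prim g T / T) (at s)" for s
    using DERIV_shift[of "mean_free_prim T g" "g s - prim g T / T" s T] d[of T "s + T"] per by simp
  have "mean_free_prim T g (t + T) - mean_free_prim T g (0 + T) = mean_free_prim T g t - mean_free_prim T g 0"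
    by (rule diff_eq_of_derivs_eq[OF s d])
  moreover have "mean_free_prim T g T - mean_free_prim T g 0 = (prim g T - prim g T / T * T) - (prim g 0 - prim g T / T * 0)"
  proof (rule diff_eq_of_derivs_eq[OF d])
    fix x
    have "((\<lambda>x. prim g x - m * x) has_real_derivative g x - m) (at x)" for m
      by (auto intro!: derivative_eq_intros prim_deriv g)
    then show "((\<lambda>x. prim g x - prim g T / T * x) has_real_derivative g x - prim g T / T) (at x)" .
  qed
  moreover have "T \<noteq> 0" using T by simp
  ultimately show ?thesis using prim_0[OF g] by simp
qed

lemma abs_weighted_sum_le:
  fixes p q :: real
  assumes "p \<ge> 0" "q \<ge> 0" "\<bar>x\<bar> \<le> A" "\<bar>y\<bar> \<le> B"
  shows "\<bar>- (p * x) - q * y\<bar> \<le> p * A + q * B"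
proof -
  have "\<bar>- (p * x) - q * y\<bar> \<le> \<bar>p * x\<bar> + \<bar>q * y\<bar>" by linarith
  also have "\<dots> = p * \<bar>x\<bar> + q * \<bar>y\<bar>" using assms by (simp add: abs_mult)
  also have "\<dots> \<le> p * A + q * B" using assms by (intro add_mono mult_left_mono)
  finally show ?thesis .
qed

lemma mean_free_prim_diff_oscillation:
  assumes T: "T > 0"
    and g: "continuous_on UNIV g" "\<And>t. g (t + T) = g t"
    and h: "continuous_on UNIV h" "\<And>t. h (t + T) = h t"
    and osc: "\<And>s t. \<bar>(g s - h s) - (g t - h t)\<bar> \<le> K"
  shows "\<bar>(mean_free_prim T g s - mean_free_prim T h s) - (mean_free_prim T g t - mean_free_prim T h t)\<bar> \<le> K * T / 4"
proof (rule periodic_oscillation_bound[of T "\<lambda>t. mean_free_prim T g t - mean_free_prim T h t"])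
  show "((\<lambda>t. mean_free_prim T g t - mean_free_prim T h t) has_real_derivative
          (g t - prim g T / T) - (h t - prim h T / T)) (at t)" for t
    by (intro derivative_intros mean_free_prim_deriv g h)
  show "\<bar>(g s - prim g T / T - (h s - prim h T / T)) - (g t - prim g T / T - (h t - prim h T / T))\<bar> \<le> K"
    for s t using osc[of s t] by (simp add: algebra_simps)
qed (use T mean_free_prim_periodic g h in auto)

section \<open>Periodic solutions of a weakly forced oscillator\<close>

text \<open>
The equation \<open>v'' + \<eta> v' + c + \<epsilon> F t v = 0\<close> is treated by a Lyapunov-Schmidt reduction with \<open>F\<close>
a bounded periodic force; for \<open>F = M sin (2 v + ...)\<close> the Lipschitz constant in \<open>v\<close> is twice
the bound, hence the factor 2 in the Lipschitz condition. The damping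
is kept on the side of the perturbation, so that \<open>\<eta> = 0\<close> needs no separate argument.
\<close>
locale periodic_forcing =
  fixes T \<epsilon> \<eta> M :: real and F :: "real \<Rightarrow> real \<Rightarrow> real"
  assumes T_pos: "T > 0" and eps_nonneg: "\<epsilon> \<ge> 0" and eta_nonneg: "\<eta> \<ge> 0"
    and F_cont: "\<And>v. continuous_on UNIV v \<Longrightarrow> continuous_on UNIV (\<lambda>t. F t (v t))"
    and F_periodic: "\<And>t y. F (t + T) y = F t y"
    and F_bound: "\<And>t y. \<bar>F t y\<bar> \<le> M"
    and F_lipschitz: "\<And>t y z. \<bar>F t y - F t z\<bar> \<le> 2 * M * \<bar>y - z\<bar>"
    and small: "T / 4 * (\<epsilon> * M * T + 2 * \<eta>) < 1"
begin

text \<open>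
Integrating the equation twice, with the means removed each time, yields
\<open>v = v 0 + response v\<close>. A solution of this fixed point equation satisfies the differential
equation up to a constant, namely \<open>c + \<epsilon> * mean (F t (v t))\<close>.
\<close>
definition "torque v = mean_free_prim T (\<lambda>t. F t (v t))"
definition "velocity v t = - \<epsilon> * torque v t - \<eta> * v t"
definition "response v = mean_free_prim T (velocity v)"

text \<open>
The Lipschitz constant of \<open>response\<close> in the supremum norm.
\<close>
definition "\<kappa> = T / 4 * (\<epsilon> * M * T + 2 * \<eta>)"

lemma M_nonneg: "M \<ge> 0" using F_bound[of 0 0] by linarith

lemma kappa: "0 \<le> \<kappa>" "\<kappa> < 1"
  using small T_pos eps_nonneg eta_nonneg M_nonneg by (auto simp: \<kappa>_def)

definition "cont_periodic v \<longleftrightarrow> continuous_on UNIV v \<and> (\<forall>t. v (t + T) = v t)"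

context
  fixes v :: "real \<Rightarrow> real"
  assumes v: "cont_periodic v"
begin

lemma force_cont_periodic: "cont_periodic (\<lambda>t. F t (v t))"
  using v F_cont F_periodic by (auto simp: cont_periodic_def)

lemma torque_cont_periodic: "cont_periodic (torque v)"
  using force_cont_periodic mean_free_prim_continuous mean_free_prim_periodic T_pos by (auto simp: cont_periodic_def torque_def)

lemma velocity_cont_periodic: "cont_periodic (velocity v)"
  using torque_cont_periodic v by (auto simp: cont_periodic_def velocity_def intro!: continuous_intros)

lemma response_cont_periodic: "cont_periodic (response v)"
  using velocity_cont_periodic mean_free_prim_continuous mean_free_prim_periodic T_pos by (auto simp: cont_periodic_def response_def)

lemma response_0: "response v 0 = 0"
  using velocity_cont_periodic mean_free_prim_0 by (auto simp: response_def cont_periodic_def)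

lemma torque_deriv:
  "(torque v has_real_derivative F t (v t) - prim (\<lambda>t. F t (v t)) T / T) (at t)"
  unfolding torque_def using force_cont_periodic by (intro mean_free_prim_deriv) (auto simp: cont_periodic_def)

lemma response_deriv:
  "(response v has_real_derivative velocity v t - prim (velocity v) T / T) (at t)"
  unfolding response_def using velocity_cont_periodic by (intro mean_free_prim_deriv) (auto simp: cont_periodic_def)

end

lemma response_contraction:
  assumes v: "cont_periodic v" and w: "cont_periodic w" and d: "\<And>t. \<bar>v t - w t\<bar> \<le> d"
  shows "\<bar>response v t - response w t\<bar> \<le> \<kappa> * d"
proof -
  have F: "\<bar>F s (v s) - F s (w s)\<bar> \<le> 2 * M * d" for s
    using F_lipschitz[of s "v s" "w s"] mult_left_mono[OF d[of s], of "2 * M"] M_nonneg by linarith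
  have "\<bar>(F s (v s) - F s (w s)) - (F t (v t) - F t (w t))\<bar> \<le> 4 * M * d" for s t
    using F[of s] F[of t] by linarith
  then have tq: "\<bar>(torque v s - torque w s) - (torque v t - torque w t)\<bar> \<le> 4 * M * d * T / 4" for s t
    unfolding torque_def
    using force_cont_periodic[OF v] force_cont_periodic[OF w] T_pos
    by (intro mean_free_prim_diff_oscillation) (auto simp: cont_periodic_def)
  have vel: "\<bar>(velocity v s - velocity w s) - (velocity v t - velocity w t)\<bar> \<le> (\<epsilon> * M * T + 2 * \<eta>) * d"
    for s t
  proof -
    have "(velocity v s - velocity w s) - (velocity v t - velocity w t)
       = - (\<epsilon> * ((torque v s - torque w s) - (torque v t - torque w t)))
         - \<eta> * ((v s - w s) - (v t - w t))"
      by (simp add: velocity_def algebra_simps)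
    also have "\<bar>\<dots>\<bar> \<le> \<epsilon> * (4 * M * d * T / 4) + \<eta> * (2 * d)"
    proof (rule abs_weighted_sum_le[OF eps_nonneg eta_nonneg tq])
      show "\<bar>v s - w s - (v t - w t)\<bar> \<le> 2 * d" using d[of s] d[of t] by linarith
    qed
    finally show ?thesis by (simp add: algebra_simps)
  qed
  have "\<bar>(response v t - response w t) - (response v 0 - response w 0)\<bar>
      \<le> ((\<epsilon> * M * T + 2 * \<eta>) * d) * T / 4"
    unfolding response_def using velocity_cont_periodic[OF v] velocity_cont_periodic[OF w] T_pos vel
    by (intro mean_free_prim_diff_oscillation) (auto simp: cont_periodic_def)
  then show ?thesis using response_0[OF v] response_0[OF w] by (simp add: \<kappa>_def algebra_simps)
qed

lemma cont_periodic_bcontfun: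
  assumes "cont_periodic v"
  shows "v \<in> bcontfun"
proof -
  have "compact (v ` {0..T})"
    using assms by (intro compact_continuous_image) (auto simp: cont_periodic_def intro: continuous_on_subset)
  moreover have "range v \<subseteq> v ` {0..T}"
  proof
    fix y assume "y \<in> range v"
    then obtain t where t: "y = v t" by blast
    obtain r where "0 \<le> r" "r < 0 + T" "v r = v t"
      using periodic_shift_into[of T v 0 t] T_pos assms by (auto simp: cont_periodic_def)
    with t show "y \<in> v ` {0..T}" by (intro image_eqI[of _ _ r]) auto
  qed
  ultimately have "bounded (range v)" using bounded_subset compact_imp_bounded by blast
  with assms show ?thesis by (auto simp: bcontfun_def cont_periodic_def)
qed

definition "periodic_funs = {w :: real \<Rightarrow>\<^sub>C real. cont_periodic w}"

lemma complete_periodic_funs: "complete periodic_funs"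
proof -
  have ev: "continuous_on UNIV (\<lambda>w :: real \<Rightarrow>\<^sub>C real. w t)" for t
    unfolding continuous_on_iff using dist_fun_lt_imp_dist_val_lt by blast
  have "periodic_funs = {w. \<forall>t. apply_bcontfun w (t + T) = w t}"
    by (auto simp: periodic_funs_def cont_periodic_def)
  also have "closed \<dots>"
    by (intro closed_Collect_all closed_Collect_eq ev)
  finally show ?thesis by (simp add: complete_eq_closed)
qed

lemma fixed_point_exists:
  "\<exists>w \<in> periodic_funs. \<forall>t. apply_bcontfun w t = \<xi> + response w t"
proof -
  define f :: "(real \<Rightarrow>\<^sub>C real) \<Rightarrow> (real \<Rightarrow>\<^sub>C real)"
    where "f w = Bcontfun (\<lambda>t. \<xi> + response w t)" for w
  have shifted: "cont_periodic (\<lambda>t. \<xi> + response w t)" if "w \<in> periodic_funs" for w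
    using response_cont_periodic[of w] that by (auto simp: periodic_funs_def cont_periodic_def intro!: continuous_intros)
  have f: "apply_bcontfun (f w) = (\<lambda>t. \<xi> + response w t)" if "w \<in> periodic_funs" for w
    unfolding f_def using cont_periodic_bcontfun[OF shifted[OF that]] by (rule Bcontfun_inverse)
  have "\<exists>!w\<in>periodic_funs. f w = w"
  proof (rule Banach_fix[OF complete_periodic_funs _ kappa])
    have "const_bcontfun 0 \<in> periodic_funs" by (auto simp: periodic_funs_def cont_periodic_def const_bcontfun.rep_eq)
    then show "periodic_funs \<noteq> {}" by blast
    show "f ` periodic_funs \<subseteq> periodic_funs"
    proof
      fix y assume "y \<in> f ` periodic_funs"
      then obtain w where "w \<in> periodic_funs" "y = f w" by blast
      then show "y \<in> periodic_funs" using f[of w] shifted[of w] unfolding periodic_funs_def by auto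
    qed
    fix v w assume vw: "v \<in> periodic_funs" "w \<in> periodic_funs"
    show "dist (f v) (f w) \<le> \<kappa> * dist v w"
    proof (rule dist_bound)
      fix t
      have "\<bar>response v t - response w t\<bar> \<le> \<kappa> * dist v w"
        using vw dist_bounded[of v _ w] by (intro response_contraction) (auto simp: periodic_funs_def dist_real_def)
      then show "dist (f v t) (f w t) \<le> \<kappa> * dist v w" using f vw by (simp add: dist_real_def)
    qed
  qed
  then obtain w where "w \<in> periodic_funs" "f w = w" by blast
  then show ?thesis using f[of w] by (intro bexI[of _ w]) (metis, auto)
qed

lemma fixed_point_stable:
  assumes v: "v \<in> periodic_funs" "\<And>t. apply_bcontfun v t = \<xi> + response v t"
    and w: "w \<in> periodic_funs" "\<And>t. apply_bcontfun w t = \<zeta> + response w t"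
  shows "dist v w \<le> \<bar>\<xi> - \<zeta>\<bar> / (1 - \<kappa>)"
proof -
  have "dist v w \<le> \<bar>\<xi> - \<zeta>\<bar> + \<kappa> * dist v w"
  proof (rule dist_bound)
    fix t
    have "\<bar>response v t - response w t\<bar> \<le> \<kappa> * dist v w"
      using v w dist_bounded[of v _ w] by (intro response_contraction) (auto simp: periodic_funs_def dist_real_def)
    then show "dist (v t) (w t) \<le> \<bar>\<xi> - \<zeta>\<bar> + \<kappa> * dist v w"
      unfolding dist_real_def v(2)[of t] w(2)[of t] by linarith
  qed
  then show ?thesis using kappa by (simp add: field_simps)
qed

text \<open>
The a priori bound uses the bound \<open>M\<close> of \<open>F\<close>: if \<open>Osc\<close> is the oscillation of a fixed point, then
\<open>Osc \<le> \<epsilon> M T\<^sup>2 / 8 + (\<eta> T / 4) Osc\<close>, and \<open>\<eta> T / 4 < 1\<close>.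
\<close>
lemma fixed_point_close:
  assumes v: "cont_periodic v" "\<And>t. v t = \<xi> + response v t"
    and \<delta>: "\<epsilon> * M * T\<^sup>2 / 8 \<le> \<delta> * (1 - \<eta> * T / 4)"
  shows "\<bar>v t - \<xi>\<bar> \<le> \<delta>"
proof -
  define Osc where "Osc = (SUP p. \<bar>v (fst p) - v (snd p)\<bar>)"
  have "bounded (range v)" using cont_periodic_bcontfun[OF v(1)] by (auto simp: bcontfun_def)
  then obtain B where B: "\<And>t. \<bar>v t\<bar> \<le> B" by (auto simp: bounded_iff)
  have bdd: "bdd_above (range (\<lambda>p. \<bar>v (fst p) - v (snd p)\<bar>))"
  proof (rule bdd_aboveI[of _ "2 * B"])
    fix x assume "x \<in> range (\<lambda>p. \<bar>v (fst p) - v (snd p)\<bar>)"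
    then obtain p where "x = \<bar>v (fst p) - v (snd p)\<bar>" by blast
    then show "x \<le> 2 * B" using B[of "fst p"] B[of "snd p"] by linarith
  qed
  have le: "\<bar>v s - v t\<bar> \<le> Osc" for s t
    unfolding Osc_def using cSUP_upper[OF UNIV_I bdd, of "(s, t)"] by simp
  have FF: "\<bar>(F s (v s) - c) - (F t (v t) - c)\<bar> \<le> 2 * M" for s t c
    using F_bound[of s "v s"] F_bound[of t "v t"] by linarith
  have tq: "\<bar>torque v s - torque v t\<bar> \<le> 2 * M * T / 4" for s t
    using torque_cont_periodic[OF v(1)] torque_deriv[OF v(1)] FF
    by (intro periodic_oscillation_bound[OF T_pos, where P = "torque v"]) (auto simp: cont_periodic_def)
  have vel: "\<bar>velocity v s - velocity v t\<bar> \<le> \<epsilon> * (2 * M * T / 4) + \<eta> * Osc" for s t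
  proof -
    have "velocity v s - velocity v t = - (\<epsilon> * (torque v s - torque v t)) - \<eta> * (v s - v t)"
      by (simp add: velocity_def algebra_simps)
    also have "\<bar>\<dots>\<bar> \<le> \<epsilon> * (2 * M * T / 4) + \<eta> * Osc"
      by (rule abs_weighted_sum_le[OF eps_nonneg eta_nonneg tq le])
    finally show ?thesis .
  qed
  have resp: "\<bar>response v s - response v t\<bar> \<le> (\<epsilon> * (2 * M * T / 4) + \<eta> * Osc) * T / 4" for s t
    using response_cont_periodic[OF v(1)] response_deriv[OF v(1)] vel
    by (intro periodic_oscillation_bound[OF T_pos, where P = "response v"]) (auto simp: cont_periodic_def)
  have "Osc \<le> (\<epsilon> * (2 * M * T / 4) + \<eta> * Osc) * T / 4"
    unfolding Osc_def
  proof (rule cSUP_least)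
    fix p :: "real \<times> real"
    show "\<bar>v (fst p) - v (snd p)\<bar> \<le> (\<epsilon> * (2 * M * T / 4) + \<eta> * (SUP p. \<bar>v (fst p) - v (snd p)\<bar>)) * T / 4"
      using resp[of "fst p" "snd p"] v(2)[of "fst p"] v(2)[of "snd p"] unfolding Osc_def by simp
  qed simp
  then have "Osc * (1 - \<eta> * T / 4) \<le> \<epsilon> * M * T\<^sup>2 / 8"
    by (simp add: power2_eq_square algebra_simps)
  also note \<delta>
  finally have "Osc * (1 - \<eta> * T / 4) \<le> \<delta> * (1 - \<eta> * T / 4)" .
  moreover have "1 - \<eta> * T / 4 > 0"
  proof -
    have "0 \<le> T * (\<epsilon> * M * T)" "0 \<le> T * \<eta>"
      using T_pos eps_nonneg eta_nonneg M_nonneg by auto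
    then show ?thesis using small by (simp add: algebra_simps)
  qed
  ultimately have "Osc \<le> \<delta>" by (simp add: mult_le_cancel_right)
  moreover have "v 0 = \<xi>" using v(2)[of 0] response_0[OF v(1)] by simp
  ultimately show ?thesis using le[of t 0] by simp
qed

text \<open>
For each \<open>\<xi>\<close> there is exactly one fixed point with \<open>v 0 = \<xi>\<close>, it depends continuously on \<open>\<xi>\<close> and
stays within \<open>\<delta>\<close> of \<open>\<xi>\<close>. It solves the equation as soon as the integral of \<open>c + \<epsilon> F t (v t)\<close> over a
period vanishes. By the intermediate value theorem this happens for some \<open>\<xi>\<close> between \<open>a\<close> and \<open>b\<close>,
because that integral has opposite signs for all functions near \<open>a\<close> and near \<open>b\<close>.
\<close>
theorem periodic_solution:
  assumes ab: "a \<le> b"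
    and \<delta>: "\<epsilon> * M * T\<^sup>2 / 8 \<le> \<delta> * (1 - \<eta> * T / 4)"
    and low: "\<And>v G. \<lbrakk>continuous_on UNIV v; \<And>t. \<bar>v t - a\<bar> \<le> \<delta>;
        \<And>t. (G has_real_derivative F t (v t)) (at t)\<rbrakk> \<Longrightarrow> \<epsilon> * (G T - G 0) + c * T \<le> 0"
    and high: "\<And>v G. \<lbrakk>continuous_on UNIV v; \<And>t. \<bar>v t - b\<bar> \<le> \<delta>;
        \<And>t. (G has_real_derivative F t (v t)) (at t)\<rbrakk> \<Longrightarrow> 0 \<le> \<epsilon> * (G T - G 0) + c * T"
  obtains v v' where "\<And>t. v (t + T) = v t" "\<And>t. (v has_real_derivative v' t) (at t)"
    "\<And>t. (v' has_real_derivative - (\<eta> * v' t + c + \<epsilon> * F t (v t))) (at t)"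
proof -
  obtain V where V: "\<And>\<xi>. V \<xi> \<in> periodic_funs" "\<And>\<xi> t. apply_bcontfun (V \<xi>) t = \<xi> + response (V \<xi>) t"
    using fixed_point_exists by metis
  have cont_periodic: "cont_periodic (V \<xi>)" for \<xi> using V(1)[of \<xi>] by (simp add: periodic_funs_def)
  have Fc: "continuous_on UNIV (\<lambda>t. F t (V \<xi> t))" for \<xi>
    by (intro F_cont) auto
  define G where "G \<xi> = prim (\<lambda>t. F t (V \<xi> t))" for \<xi>
  have G: "(G \<xi> has_real_derivative F t (V \<xi> t)) (at t)" "G \<xi> 0 = 0" for \<xi> t
    unfolding G_def using prim_deriv[OF Fc] prim_0[OF Fc] by auto
  have close: "\<bar>V \<xi> t - \<xi>\<bar> \<le> \<delta>" for \<xi> t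
    by (rule fixed_point_close[OF cont_periodic V(2) \<delta>])
  define C where "C = T * (2 * M / (1 - \<kappa>))"
  have lip: "\<bar>G \<xi> T - G \<zeta> T\<bar> \<le> C * \<bar>\<xi> - \<zeta>\<bar>" for \<xi> \<zeta>
  proof -
    have "\<exists>z. 0 < z \<and> z < T \<and> (G \<xi> T - G \<zeta> T) - (G \<xi> 0 - G \<zeta> 0) = (T - 0) * (F z (V \<xi> z) - F z (V \<zeta> z))"
      using T_pos by (intro MVT2) (auto intro!: derivative_intros G)
    then obtain z where "G \<xi> T - G \<zeta> T = T * (F z (V \<xi> z) - F z (V \<zeta> z))" by (auto simp: G)
    then have "\<bar>G \<xi> T - G \<zeta> T\<bar> = T * \<bar>F z (V \<xi> z) - F z (V \<zeta> z)\<bar>"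
      using T_pos by (simp add: abs_mult)
    also have "\<dots> \<le> T * (2 * M * \<bar>V \<xi> z - V \<zeta> z\<bar>)"
      using F_lipschitz T_pos by (intro mult_left_mono) auto
    also have "\<bar>V \<xi> z - V \<zeta> z\<bar> \<le> \<bar>\<xi> - \<zeta>\<bar> / (1 - \<kappa>)"
      using dist_bounded[of "V \<xi>" z "V \<zeta>"] fixed_point_stable[OF V V, of \<xi> \<zeta>]
      by (simp add: dist_real_def)
    finally show ?thesis using T_pos M_nonneg by (simp add: C_def mult_left_mono)
  qed
  have C: "C \<ge> 0" using T_pos M_nonneg kappa by (simp add: C_def)
  have "C-lipschitz_on UNIV (\<lambda>\<xi>. G \<xi> T)"
    using lip C by (intro lipschitz_onI) (auto simp: dist_real_def)
  then have cont: "continuous_on UNIV (\<lambda>\<xi>. G \<xi> T)" by (rule lipschitz_on_continuous_on)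
  have "\<exists>\<xi>. a \<le> \<xi> \<and> \<xi> \<le> b \<and> \<epsilon> * G \<xi> T + c * T = 0"
  proof (rule IVT')
    show "\<epsilon> * G a T + c * T \<le> 0" using low[of "V a" "G a"] close G by auto
    show "0 \<le> \<epsilon> * G b T + c * T" using high[of "V b" "G b"] close G by auto
    show "continuous_on {a..b} (\<lambda>\<xi>. \<epsilon> * G \<xi> T + c * T)"
      by (intro continuous_intros continuous_on_subset[OF cont]) auto
  qed (rule ab)
  then obtain \<xi> where \<xi>: "\<epsilon> * G \<xi> T + c * T = 0" by blast
  then have mean: "\<epsilon> * (G \<xi> T / T) = - c" using T_pos by (simp add: field_simps)
  define v' where "v' t = velocity (V \<xi>) t - prim (velocity (V \<xi>)) T / T" for t
  have v: "(V \<xi> has_real_derivative v' t) (at t)" for t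
  proof -
    have "((\<lambda>t. \<xi> + response (V \<xi>) t) has_real_derivative v' t) (at t)"
      unfolding v'_def by (auto intro!: derivative_eq_intros response_deriv[OF cont_periodic])
    moreover have "apply_bcontfun (V \<xi>) = (\<lambda>t. \<xi> + response (V \<xi>) t)"
      by (rule ext) (rule V(2))
    ultimately show ?thesis by (rule ssubst[rotated])
  qed
  have v'_eq: "v' = (\<lambda>t. - \<epsilon> * torque (V \<xi>) t - \<eta> * V \<xi> t - prim (velocity (V \<xi>)) T / T)"
    by (simp add: v'_def velocity_def fun_eq_iff)
  have tq: "(torque (V \<xi>) has_real_derivative F t (V \<xi> t) - G \<xi> T / T) (at t)" for t
    unfolding G_def by (rule torque_deriv[OF cont_periodic])
  have "((\<lambda>t. - \<epsilon> * torque (V \<xi>) t - \<eta> * V \<xi> t - prim (velocity (V \<xi>)) T / T)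
      has_real_derivative - \<epsilon> * (F t (V \<xi> t) - G \<xi> T / T) - \<eta> * v' t - 0) (at t)" for t
    by (intro DERIV_diff DERIV_cmult tq v DERIV_const)
  then have "(v' has_real_derivative - \<epsilon> * (F t (V \<xi> t) - G \<xi> T / T) - \<eta> * v' t) (at t)" for t
    unfolding v'_eq[symmetric] by simp
  moreover have "- \<epsilon> * (F t (V \<xi> t) - G \<xi> T / T) - \<eta> * v' t = - (\<eta> * v' t + c + \<epsilon> * F t (V \<xi> t))" for t
    using mean by (simp add: right_diff_distrib)
  ultimately have "(v' has_real_derivative - (\<eta> * v' t + c + \<epsilon> * F t (V \<xi> t))) (at t)" for t
    by metis
  then show thesis
    using v cont_periodic by (intro that[of "V \<xi>" v']) (auto simp: cont_periodic_def)
qed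

end

section \<open>Kepler motion and the resonant torque\<close>

lemma kepler_equation:
  assumes "0 \<le> e" "e < 1"
  shows "ecc_anomaly e t - e * sin (ecc_anomaly e t) = t"
  using theI'[OF kepler_ex1[OF assms, of t]] by (simp add: ecc_anomaly_def)

lemma ecc_anomaly_eqI:
  assumes "0 \<le> e" "e < 1" "u - e * sin u = t"
  shows "ecc_anomaly e t = u"
  unfolding ecc_anomaly_def by (rule the1_equality[OF kepler_ex1]) (use assms in auto)

lemma sin_dist_le: "\<bar>sin a - sin b\<bar> \<le> \<bar>a - b\<bar>" for a b :: real
proof -
  have "\<bar>sin a - sin b\<bar> = 2 * \<bar>sin ((a - b) / 2)\<bar> * \<bar>cos ((a + b) / 2)\<bar>"
    by (simp add: sin_diff_sin abs_mult)
  also have "\<dots> \<le> 2 * \<bar>(a - b) / 2\<bar> * 1"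
    by (intro mult_mono abs_sin_x_le_abs_x) auto
  finally show ?thesis by simp
qed

lemma cos_dist_le: "\<bar>cos a - cos b\<bar> \<le> \<bar>a - b\<bar>" for a b :: real
  using sin_dist_le[of "a + pi / 2" "b + pi / 2"] by (simp add: sin_add)

lemma one_minus_half_square_le_cos: "1 - x\<^sup>2 / 2 \<le> cos x" for x :: real
proof -
  have "(sin (x / 2))\<^sup>2 \<le> (x / 2)\<^sup>2"
    using abs_sin_x_le_abs_x[of "x / 2"] abs_le_square_iff by blast
  then show ?thesis using cos_double_sin[of "x / 2"] by (simp add: power_divide)
qed

context
  fixes e :: real
  assumes e: "0 \<le> e" "e < 1"
begin

lemma ecc_anomaly_shift: "ecc_anomaly e (t + of_int n * (2 * pi)) = ecc_anomaly e t + of_int n * (2 * pi)"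
proof (rule ecc_anomaly_eqI[OF e])
  have "sin (ecc_anomaly e t + of_int n * (2 * pi)) = sin (ecc_anomaly e t)"
    by (rule int_periodic) simp
  then show "ecc_anomaly e t + of_int n * (2 * pi) - e * sin (ecc_anomaly e t + of_int n * (2 * pi))
      = t + of_int n * (2 * pi)"
    using kepler_equation[OF e, of t] by simp
qed

lemma ecc_anomaly_reflect: "ecc_anomaly e (2 * pi - t) = 2 * pi - ecc_anomaly e t"
proof (rule ecc_anomaly_eqI[OF e])
  have "sin (2 * pi - ecc_anomaly e t) = - sin (ecc_anomaly e t)" by (simp add: sin_diff)
  then show "2 * pi - ecc_anomaly e t - e * sin (2 * pi - ecc_anomaly e t) = 2 * pi - t"
    using kepler_equation[OF e, of t] by simp
qed

lemma ecc_anomaly_continuous: "continuous_on UNIV (ecc_anomaly e)"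
proof -
  have "\<bar>ecc_anomaly e t - ecc_anomaly e s\<bar> \<le> 1 / (1 - e) * \<bar>t - s\<bar>" for t s
  proof -
    let ?u = "ecc_anomaly e t" and ?w = "ecc_anomaly e s"
    have "?u - ?w = (t - s) + e * (sin ?u - sin ?w)"
      using kepler_equation[OF e, of t] kepler_equation[OF e, of s] by (simp add: algebra_simps)
    then have "\<bar>?u - ?w\<bar> \<le> \<bar>t - s\<bar> + \<bar>e * (sin ?u - sin ?w)\<bar>" by linarith
    also have "\<bar>e * (sin ?u - sin ?w)\<bar> \<le> e * \<bar>?u - ?w\<bar>"
      using e sin_dist_le[of ?u ?w] by (simp add: abs_mult mult_left_mono)
    finally have "\<bar>?u - ?w\<bar> * (1 - e) \<le> \<bar>t - s\<bar>" by (simp add: algebra_simps)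
    then show ?thesis using e by (simp add: field_simps)
  qed
  then have "(1 / (1 - e))-lipschitz_on UNIV (ecc_anomaly e)"
    using e by (intro lipschitz_onI) (auto simp: dist_real_def)
  then show ?thesis by (rule lipschitz_on_continuous_on)
qed

lemma orbital_radius_bounds: "1 - e \<le> orbital_radius e t" "orbital_radius e t \<le> 1 + e"
  and orbital_radius_pos: "0 < orbital_radius e t"
proof -
  have "\<bar>e * cos (ecc_anomaly e t)\<bar> \<le> e * 1"
    unfolding abs_mult using e by (intro mult_mono) auto
  then show "1 - e \<le> orbital_radius e t" "orbital_radius e t \<le> 1 + e" "0 < orbital_radius e t"
    using e by (auto simp: orbital_radius_def abs_le_iff)
qed

lemma cos_true_anomaly:
    "cos (true_anomaly e t) = (cos (ecc_anomaly e t) - e) / orbital_radius e t"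
  and sin_true_anomaly:
    "sin (true_anomaly e t) = sqrt (1 - e\<^sup>2) * sin (ecc_anomaly e t) / orbital_radius e t"
  using true_anomaly_polar[OF e, of t] orbital_radius_pos[of t] by (auto simp: field_simps)

lemma orbital_radius_continuous: "continuous_on UNIV (orbital_radius e)"
  unfolding orbital_radius_def[abs_def] by (intro continuous_intros ecc_anomaly_continuous)

lemma trig_true_anomaly_continuous:
  "continuous_on UNIV (\<lambda>t. cos (true_anomaly e t))" "continuous_on UNIV (\<lambda>t. sin (true_anomaly e t))"
  using orbital_radius_pos unfolding cos_true_anomaly sin_true_anomaly
  by (auto intro!: continuous_intros ecc_anomaly_continuous orbital_radius_continuous
      simp: less_imp_neq[THEN not_sym])

lemma trig_ecc_anomaly_shift:
  "cos (ecc_anomaly e (t + of_int n * (2 * pi))) = cos (ecc_anomaly e t)"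
  "sin (ecc_anomaly e (t + of_int n * (2 * pi))) = sin (ecc_anomaly e t)"
  unfolding ecc_anomaly_shift by (rule int_periodic, simp)+

lemma orbital_radius_shift: "orbital_radius e (t + of_int n * (2 * pi)) = orbital_radius e t"
  by (simp add: orbital_radius_def trig_ecc_anomaly_shift)

lemma trig_true_anomaly_shift:
  "cos (true_anomaly e (t + of_int n * (2 * pi))) = cos (true_anomaly e t)"
  "sin (true_anomaly e (t + of_int n * (2 * pi))) = sin (true_anomaly e t)"
  by (simp_all add: cos_true_anomaly sin_true_anomaly orbital_radius_shift trig_ecc_anomaly_shift)

end

text \<open>
With \<open>x = y + k t\<close> a \<open>p:q\<close> resonance becomes a periodic function \<open>y\<close>, where \<open>k = p / q\<close>.
\<close>
definition resonant_torque :: "real \<Rightarrow> real \<Rightarrow> real \<Rightarrow> real \<Rightarrow> real" where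
  "resonant_torque e k t y = sin (2 * (y + k * t) - 2 * true_anomaly e t) / orbital_radius e t ^ 3"

lemma deriv_spin_orbit_potential:
  "deriv (\<lambda>y. spin_orbit_potential e y t) (v + k * t) = resonant_torque e k t v"
proof -
  have "((\<lambda>y. - (1 / (2 * c)) * cos (2 * y - 2 * f)) has_real_derivative sin (2 * x - 2 * f) / c) (at x)"
    for c f x :: real
    by (rule derivative_eq_intros refl)+ (simp add: field_simps)
  then show ?thesis
    unfolding spin_orbit_potential_def resonant_torque_def by (intro DERIV_imp_deriv)
qed

text \<open>
In this form only the sine and cosine of the true anomaly occur. They are continuous and periodic
in \<open>t\<close>, whereas the principal value of the angle jumps at every passage of the apocentre.
\<close>
lemma resonant_torque_eq:
  "resonant_torque e k t y =
     (sin (2 * (y + k * t)) * (2 * (cos (true_anomaly e t))\<^sup>2 - 1)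
      - cos (2 * (y + k * t)) * (2 * sin (true_anomaly e t) * cos (true_anomaly e t)))
     / orbital_radius e t ^ 3"
  unfolding resonant_torque_def sin_diff by (simp add: cos_double_cos sin_double)

context
  fixes e :: real
  assumes e: "0 \<le> e" "e < 1"
begin

lemma resonant_torque_continuous:
  assumes "continuous_on UNIV v"
  shows "continuous_on UNIV (\<lambda>t. resonant_torque e k t (v t))"
  unfolding resonant_torque_eq
  using orbital_radius_pos[OF e]
  by (auto intro!: continuous_intros assms orbital_radius_continuous[OF e]
      trig_true_anomaly_continuous[OF e] simp: less_imp_neq[THEN not_sym])

lemma resonant_torque_periodic:
  "resonant_torque e (of_int p / of_int q) (t + 2 * pi * of_int q) y
    = resonant_torque e (of_int p / of_int q) t y" if "q \<noteq> 0"
proof -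
  have t: "t + 2 * pi * of_int q = t + of_int q * (2 * pi)" by simp
  have arg: "2 * (y + of_int p / of_int q * (t + of_int q * (2 * pi)))
      = 2 * (y + of_int p / of_int q * t) + of_int (2 * p) * (2 * pi)"
    using that by (simp add: field_simps)
  have "sin (2 * (y + of_int p / of_int q * t) + of_int (2 * p) * (2 * pi))
      = sin (2 * (y + of_int p / of_int q * t))"
    "cos (2 * (y + of_int p / of_int q * t) + of_int (2 * p) * (2 * pi))
      = cos (2 * (y + of_int p / of_int q * t))"
    by (rule int_periodic, simp)+
  then show ?thesis
    unfolding resonant_torque_eq t arg trig_true_anomaly_shift[OF e] orbital_radius_shift[OF e]
    by presburger
qed

lemma inverse_radius_cube_le: "1 / orbital_radius e t ^ 3 \<le> 1 / (1 - e) ^ 3"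
  using orbital_radius_bounds[OF e, of t] e
  by (intro divide_left_mono power_mono mult_pos_pos zero_less_power) auto

lemma resonant_torque_bound: "\<bar>resonant_torque e k t y\<bar> \<le> 1 / (1 - e) ^ 3"
proof -
  have "\<bar>resonant_torque e k t y\<bar> \<le> 1 / orbital_radius e t ^ 3"
    using orbital_radius_pos[OF e, of t]
    by (auto simp: resonant_torque_def abs_divide intro!: divide_right_mono)
  with inverse_radius_cube_le[of t] show ?thesis by linarith
qed

lemma resonant_torque_lipschitz:
  "\<bar>resonant_torque e k t y - resonant_torque e k t z\<bar> \<le> 2 * (1 / (1 - e) ^ 3) * \<bar>y - z\<bar>"
proof -
  have "\<bar>resonant_torque e k t y - resonant_torque e k t z\<bar>
      = \<bar>sin (2 * (y + k * t) - 2 * true_anomaly e t) - sin (2 * (z + k * t) - 2 * true_anomaly e t)\<bar>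
        * (1 / orbital_radius e t ^ 3)"
    using orbital_radius_pos[OF e, of t]
    by (simp add: resonant_torque_def abs_divide flip: diff_divide_distrib)
  also have "\<dots> \<le> (2 * \<bar>y - z\<bar>) * (1 / (1 - e) ^ 3)"
  proof (intro mult_mono inverse_radius_cube_le)
    show "\<bar>sin (2 * (y + k * t) - 2 * true_anomaly e t) - sin (2 * (z + k * t) - 2 * true_anomaly e t)\<bar>
        \<le> 2 * \<bar>y - z\<bar>"
    proof (rule order_trans[OF sin_dist_le])
      have "2 * (y + k * t) - 2 * true_anomaly e t - (2 * (z + k * t) - 2 * true_anomaly e t) = 2 * (y - z)"
        by (simp add: algebra_simps)
      then show "\<bar>2 * (y + k * t) - 2 * true_anomaly e t - (2 * (z + k * t) - 2 * true_anomaly e t)\<bar>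
          \<le> 2 * \<bar>y - z\<bar>"
        by (simp only: abs_mult abs_numeral order_refl)
    qed
  qed (use orbital_radius_pos[OF e, of t] in auto)
  finally show ?thesis by simp
qed

end

text \<open>
By the symmetry of the orbit under \<open>t \<mapsto> - t\<close> the average of the torque at a constant \<open>v\<close> is a
multiple of \<open>sin (2 v)\<close>. It is extremal at \<open>v = \<plusminus> pi / 4\<close>, which are therefore the best values at
which to compare it with the drift \<open>\<eta> (k - \<nu>)\<close>.
\<close>
lemma resonance_criterion:
  fixes p q :: int
  defines "T \<equiv> 2 * pi * of_int q" and "k \<equiv> of_int p / of_int q"
  assumes pq: "p \<noteq> 0" "q > 0" "coprime p q" and e: "0 \<le> e" "e < 1"
    and nonneg: "0 \<le> \<epsilon>" "0 \<le> \<eta>"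
    and small: "T / 4 * (\<epsilon> * (1 / (1 - e) ^ 3) * T + 2 * \<eta>) < 1"
    and \<delta>: "\<epsilon> * (1 / (1 - e) ^ 3) * T\<^sup>2 / 8 \<le> \<delta> * (1 - \<eta> * T / 4)"
    and low: "\<And>v G. \<lbrakk>\<And>t. \<bar>v t - (- pi / 4)\<bar> \<le> \<delta>;
        \<And>t. (G has_real_derivative resonant_torque e k t (v t)) (at t)\<rbrakk>
        \<Longrightarrow> \<epsilon> * (G T - G 0) + \<eta> * (k - \<nu>) * T \<le> 0"
    and high: "\<And>v G. \<lbrakk>\<And>t. \<bar>v t - pi / 4\<bar> \<le> \<delta>;
        \<And>t. (G has_real_derivative resonant_torque e k t (v t)) (at t)\<rbrakk>
        \<Longrightarrow> 0 \<le> \<epsilon> * (G T - G 0) + \<eta> * (k - \<nu>) * T"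
  shows "\<exists>x. spin_orbit_resonance p q e \<epsilon> \<nu> \<eta> x"
proof -
  have T: "T > 0" using pq by (simp add: T_def)
  interpret periodic_forcing T \<epsilon> \<eta> "1 / (1 - e) ^ 3" "resonant_torque e k"
  proof
    show "resonant_torque e k (t + T) y = resonant_torque e k t y" for t y
      unfolding T_def k_def using pq by (intro resonant_torque_periodic[OF e]) auto
  qed (use T nonneg small resonant_torque_continuous[OF e] resonant_torque_bound[OF e]
      resonant_torque_lipschitz[OF e] in auto)
  obtain v v' where v: "\<And>t. v (t + T) = v t" "\<And>t. (v has_real_derivative v' t) (at t)"
    "\<And>t. (v' has_real_derivative - (\<eta> * v' t + \<eta> * (k - \<nu>) + \<epsilon> * resonant_torque e k t (v t))) (at t)"
    by (rule periodic_solution[where a = "- pi / 4" and b = "pi / 4", OF _ \<delta> low high]) auto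
  have "spin_orbit_solution e \<epsilon> \<nu> \<eta> (\<lambda>t. v t + k * t)"
    unfolding spin_orbit_solution_def deriv_spin_orbit_potential
  proof (intro exI allI conjI)
    fix t
    show "((\<lambda>t. v t + k * t) has_real_derivative v' t + k) (at t)"
      by (auto intro!: derivative_eq_intros v)
    show "((\<lambda>t. v' t + k) has_real_derivative
        - (\<eta> * v' t + \<eta> * (k - \<nu>) + \<epsilon> * resonant_torque e k t (v t))) (at t)"
      using DERIV_add[OF v(3)[of t] DERIV_const[of k]] by simp
    show "- (\<eta> * v' t + \<eta> * (k - \<nu>) + \<epsilon> * resonant_torque e k t (v t)) + \<eta> * (v' t + k - \<nu>)
        + \<epsilon> * resonant_torque e k t (v t) = 0"
      by (simp add: algebra_simps)
  qed
  moreover have "v (t + 2 * pi * of_int q) + k * (t + 2 * pi * of_int q)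
      = v t + k * t + 2 * pi * of_int p" for t
    using v(1)[of t] pq by (simp add: T_def k_def field_simps)
  ultimately show ?thesis using pq by (auto simp: spin_orbit_resonance_def)
qed

section \<open>Synchronous resonance on a nearly circular orbit\<close>

text \<open>
With \<open>s = sqrt (1 - e\<^sup>2)\<close>, \<open>u\<close> the eccentric and \<open>f\<close> the true anomaly, one has
\<open>\<rho> cos (u - f) = \<rho> - (1 - s) sin\<^sup>2 u\<close>, and \<open>1 - s \<le> e\<^sup>2\<close>.
\<close>
lemma eccentric_minus_true_anomaly:
  assumes e: "0 \<le> e" "e \<le> 0.055"
  shows "0.9868 \<le> cos (2 * (ecc_anomaly e t - true_anomaly e t))"
    and "\<bar>sin (2 * (ecc_anomaly e t - true_anomaly e t))\<bar> \<le> 0.162"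
proof -
  have e1: "0 \<le> e" "e < 1" using e by auto
  define u where "u = ecc_anomaly e t"
  define \<rho> where "\<rho> = orbital_radius e t"
  define s where "s = sqrt (1 - e\<^sup>2)"
  define C where "C = cos (u - true_anomaly e t)"
  have \<rho>: "0 < \<rho>" "1 - e \<le> \<rho>" "\<rho> = 1 - e * cos u"
    using orbital_radius_pos[OF e1, of t] orbital_radius_bounds[OF e1, of t]
    by (auto simp: \<rho>_def orbital_radius_def u_def)
  have e2: "e\<^sup>2 \<le> 1" using e1 by (simp add: power_le_one)
  have s: "0 \<le> s" "s \<le> 1" "s\<^sup>2 = 1 - e\<^sup>2" using e2 by (auto simp: s_def)
  have "s * s \<le> 1 * s" using s by (intro mult_right_mono) auto
  then have s': "1 - s \<le> e\<^sup>2" using s(3) unfolding power2_eq_square by linarith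
  have "C = (cos u * (cos u - e) + sin u * (s * sin u)) / \<rho>"
    unfolding C_def cos_diff cos_true_anomaly[OF e1] sin_true_anomaly[OF e1]
    by (simp add: u_def \<rho>_def s_def add_divide_distrib)
  also have "cos u * (cos u - e) + sin u * (s * sin u) = \<rho> - (1 - s) * (sin u)\<^sup>2"
    unfolding \<rho>(3) by (simp add: sin_squared_eq power2_eq_square algebra_simps)
  finally have "C * \<rho> = \<rho> - (1 - s) * (sin u)\<^sup>2" using \<rho> by simp
  moreover have "(1 - s) * (sin u)\<^sup>2 \<le> e\<^sup>2 * 1"
    using s s' by (intro mult_mono) (auto simp: abs_square_le_1)
  moreover have "e\<^sup>2 \<le> 0.055 * 0.055" using e unfolding power2_eq_square by (intro mult_mono) auto
  ultimately have "(1 - C) * \<rho> \<le> 0.003025" by (simp add: algebra_simps)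
  also have "\<dots> \<le> 0.0033 * \<rho>" using \<rho>(2) e by simp
  finally have C: "0.9967 \<le> C" using \<rho>(1) by (simp add: mult_le_cancel_right)
  have "0.9967 * 0.9967 \<le> C * C" using C by (intro mult_mono) auto
  moreover have cosA: "cos (2 * (u - true_anomaly e t)) = 2 * (C * C) - 1"
    by (simp only: cos_double_cos C_def power2_eq_square)
  ultimately show c: "0.9868 \<le> cos (2 * (ecc_anomaly e t - true_anomaly e t))"
    unfolding u_def by simp
  have "0.9868 * 0.9868 \<le> (cos (2 * (ecc_anomaly e t - true_anomaly e t)))\<^sup>2"
    unfolding power2_eq_square using c by (intro mult_mono) auto
  then have "(sin (2 * (ecc_anomaly e t - true_anomaly e t)))\<^sup>2 \<le> 0.162\<^sup>2"
    unfolding sin_squared_eq by (simp add: power2_eq_square)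
  then show "\<bar>sin (2 * (ecc_anomaly e t - true_anomaly e t))\<bar> \<le> 0.162"
    by (simp only: abs_le_square_iff[symmetric]) simp
qed

lemma synchronous_cos_ge:
  assumes e: "0 \<le> e" "e \<le> 0.055" and w: "\<bar>w\<bar> \<le> \<delta>" and \<delta>: "2 * e + 2 * \<delta> \<le> 1.02"
  shows "1 / 4 \<le> cos (2 * (t - true_anomaly e t + w))"
proof -
  have e1: "0 \<le> e" "e < 1" using e by auto
  define A where "A = 2 * (ecc_anomaly e t - true_anomaly e t)"
  define b where "b = 2 * w - 2 * (e * sin (ecc_anomaly e t))"
  have "\<bar>e * sin (ecc_anomaly e t)\<bar> \<le> e * 1"
    unfolding abs_mult using e by (intro mult_mono) auto
  then have b: "\<bar>b\<bar> \<le> 1.02" unfolding b_def using w \<delta> by linarith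
  \<comment> \<open>0.4798 is \<open>1 - 1.02\<^sup>2 / 2\<close>; the final margin is \<open>0.9868 * 0.4798 - 0.162 * 1.02 > 0.3\<close>\<close>
  have "b\<^sup>2 \<le> 1.02\<^sup>2" using b by (simp only: abs_le_square_iff[symmetric])
  then have cb: "0.4798 \<le> cos b"
    using one_minus_half_square_le_cos[of b] by (simp add: power2_eq_square)
  have sb: "\<bar>sin b\<bar> \<le> 1.02" using abs_sin_x_le_abs_x[of b] b by linarith
  note A = eccentric_minus_true_anomaly[OF e, of t, folded A_def]
  have "0.9868 * 0.4798 \<le> cos A * cos b" using A(1) cb by (intro mult_mono) auto
  moreover have "\<bar>sin A * sin b\<bar> \<le> 0.162 * 1.02"
    unfolding abs_mult using A(2) sb by (intro mult_mono) auto
  ultimately have "1 / 4 \<le> cos (A + b)" by (simp add: cos_add abs_le_iff)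
  moreover have "2 * (t - true_anomaly e t + w) = A + b"
    using kepler_equation[OF e1, of t] by (simp add: A_def b_def algebra_simps)
  ultimately show ?thesis by (simp only:)
qed

text \<open>
On a nearly circular orbit \<open>f\<close> stays close to \<open>t\<close>, so the torque at \<open>v \<approx> \<plusminus> pi / 4\<close> has a fixed sign
and size at least \<open>1 / (4 (1 + e)\<^sup>3)\<close> at every instant, and no averaging is needed. The
constant 10 in the condition on \<open>2 * e * (1 - e)\<^sup>3 + 10 * \<epsilon>\<close> is \<open>2 * 5\<close>, where
\<open>5 > (pi\<^sup>2 / 2) / (1 - 0.008 pi / 2)\<close> bounds the deviation of a fixed point from its value at 0 in units
of \<open>\<epsilon> / (1 - e)\<^sup>3\<close>. The constant 0.0951 makes \<open>pi\<^sup>2 * 0.0951 + 0.008 pi\<close>, the contraction constant,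
smaller than 1; it has to admit Mimas, for which \<open>\<epsilon> / (1 - e)\<^sup>3\<close> is about 0.09506.
\<close>
lemma synchronous_resonance:
  assumes e: "0 \<le> e" "e \<le> 0.055" and \<nu>: "1 \<le> \<nu>" and \<eta>: "0 \<le> \<eta>" "\<eta> \<le> 0.008"
    and \<epsilon>: "0 \<le> \<epsilon>" "\<epsilon> \<le> 0.0951 * (1 - e) ^ 3"
    and \<delta>: "2 * e * (1 - e) ^ 3 + 10 * \<epsilon> \<le> 1.02 * (1 - e) ^ 3"
    and drift: "0.008 * (\<nu> - 1) * (1 + e) ^ 3 \<le> \<epsilon> / 4"
  shows "\<exists>x. spin_orbit_resonance 1 1 e \<epsilon> \<nu> \<eta> x"
proof -
  have e1: "0 \<le> e" "e < 1" using e by auto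
  define m where "m = \<epsilon> * (1 / (1 - e) ^ 3)"
  have pos: "(1 - e) ^ 3 > 0" "(1 + e) ^ 3 > 0" using e1 by auto
  have m: "0 \<le> m" "m \<le> 0.0951" using \<epsilon> pos by (auto simp: m_def field_simps)
  have \<delta>': "2 * e + 2 * (5 * m) \<le> 1.02" using \<delta> pos by (simp add: m_def field_simps)
  have pi2: "pi * pi \<le> 3.1416 * 3.1416" using pi_approx by (intro mult_mono) auto
  have \<eta>pi: "\<eta> * pi \<le> 0.008 * 3.1416" using \<eta> pi_approx by (intro mult_mono) auto
  have T: "1 / 4 / (1 + e) ^ 3 * (2 * pi) \<ge> 0" using pos by simp
  have drift': "\<eta> * (\<nu> - 1) \<le> \<epsilon> * (1 / 4 / (1 + e) ^ 3)"
  proof -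
    have "\<eta> * (\<nu> - 1) \<le> 0.008 * (\<nu> - 1)" using \<eta> \<nu> by (intro mult_right_mono) auto
    also have "\<dots> \<le> \<epsilon> / 4 / (1 + e) ^ 3" using drift pos by (simp add: pos_le_divide_eq)
    finally show ?thesis by simp
  qed
  have torque: "1 / 4 / (1 + e) ^ 3 \<le> cos (2 * (t - true_anomaly e t + w)) / orbital_radius e t ^ 3"
    if "\<bar>w\<bar> \<le> 5 * m" for t w
  proof (rule frac_le)
    show "1 / 4 \<le> cos (2 * (t - true_anomaly e t + w))"
      by (rule synchronous_cos_ge[OF e that \<delta>'])
    then show "0 \<le> cos (2 * (t - true_anomaly e t + w))" by linarith
    show "0 < orbital_radius e t ^ 3" using orbital_radius_pos[OF e1] by simp
    show "orbital_radius e t ^ 3 \<le> (1 + e) ^ 3"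
      using orbital_radius_bounds[OF e1, of t] orbital_radius_pos[OF e1, of t] by (intro power_mono) auto
  qed
  show ?thesis
  proof (rule resonance_criterion[where \<delta> = "5 * m"], unfold m_def[symmetric])
    have "m * (pi * pi) \<le> 0.0951 * (3.1416 * 3.1416)" by (rule mult_mono[OF m(2) pi2]) auto
    then show "2 * pi * of_int 1 / 4 * (m * (2 * pi * of_int 1) + 2 * \<eta>) < 1"
      using \<eta>pi by (simp add: algebra_simps)
    have "m * (pi * pi / 2) \<le> m * (5 * (1 - \<eta> * pi / 2))"
      using m pi2 \<eta>pi by (intro mult_left_mono) (simp_all add: algebra_simps)
    then show "m * (2 * pi * of_int 1)\<^sup>2 / 8 \<le> 5 * m * (1 - \<eta> * (2 * pi * of_int 1) / 4)"
      by (simp add: power2_eq_square algebra_simps)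
  next
    fix v G
    assume v: "\<And>t. \<bar>v t - (- pi / 4)\<bar> \<le> 5 * m"
      and G: "\<And>t. (G has_real_derivative resonant_torque e (of_int 1 / of_int 1) t (v t)) (at t)"
    have "((\<lambda>t. - G t) has_real_derivative - resonant_torque e 1 t (v t)) (at t)" for t
      using DERIV_minus[OF G[of t]] by simp
    moreover have "1 / 4 / (1 + e) ^ 3 \<le> - resonant_torque e 1 t (v t)" for t
    proof -
      have "2 * (v t + 1 * t) - 2 * true_anomaly e t
          = 2 * (t - true_anomaly e t + (v t - (- pi / 4))) - pi / 2" by (simp add: algebra_simps)
      then have "- resonant_torque e 1 t (v t)
          = cos (2 * (t - true_anomaly e t + (v t - (- pi / 4)))) / orbital_radius e t ^ 3"
        unfolding resonant_torque_def by (simp only: sin_diff) simp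
      then show ?thesis using torque[OF v[of t], of t] by simp
    qed
    ultimately have "1 / 4 / (1 + e) ^ 3 * (2 * pi - 0) \<le> - G (2 * pi) - (- G 0)"
      by (intro DERIV_growth_ge) auto
    then have "\<epsilon> * (G (2 * pi) - G 0) \<le> 0"
      using T \<epsilon> by (intro mult_nonneg_nonpos) auto
    moreover have "\<eta> * (1 - \<nu>) * (2 * pi) \<le> 0"
      using \<eta> \<nu> by (intro mult_nonpos_nonneg mult_nonneg_nonpos) auto
    ultimately have "\<epsilon> * (G (2 * pi) - G 0) + \<eta> * (1 - \<nu>) * (2 * pi) \<le> 0"
      by (rule add_nonpos_nonpos)
    then show "\<epsilon> * (G (2 * pi * of_int 1) - G 0) + \<eta> * (of_int 1 / of_int 1 - \<nu>) * (2 * pi * of_int 1) \<le> 0"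
      by simp
  next
    fix v G
    assume v: "\<And>t. \<bar>v t - pi / 4\<bar> \<le> 5 * m"
      and G: "\<And>t. (G has_real_derivative resonant_torque e (of_int 1 / of_int 1) t (v t)) (at t)"
    have "(G has_real_derivative resonant_torque e 1 t (v t)) (at t)" for t
      using G[of t] by simp
    moreover have "1 / 4 / (1 + e) ^ 3 \<le> resonant_torque e 1 t (v t)" for t
    proof -
      have "2 * (v t + 1 * t) - 2 * true_anomaly e t
          = 2 * (t - true_anomaly e t + (v t - pi / 4)) + pi / 2" by (simp add: algebra_simps)
      then have "resonant_torque e 1 t (v t)
          = cos (2 * (t - true_anomaly e t + (v t - pi / 4))) / orbital_radius e t ^ 3"
        unfolding resonant_torque_def by (simp only: sin_add) simp
      then show ?thesis using torque[OF v[of t], of t] by simp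
    qed
    ultimately have "1 / 4 / (1 + e) ^ 3 * (2 * pi - 0) \<le> G (2 * pi) - G 0"
      by (intro DERIV_growth_ge) auto
    then have "\<epsilon> * (1 / 4 / (1 + e) ^ 3 * (2 * pi)) \<le> \<epsilon> * (G (2 * pi) - G 0)"
      using \<epsilon> by (intro mult_left_mono) auto
    moreover have "\<eta> * (\<nu> - 1) * (2 * pi) \<le> \<epsilon> * (1 / 4 / (1 + e) ^ 3) * (2 * pi)"
      by (intro mult_right_mono drift') auto
    ultimately show "0 \<le> \<epsilon> * (G (2 * pi * of_int 1) - G 0) + \<eta> * (of_int 1 / of_int 1 - \<nu>) * (2 * pi * of_int 1)"
      by (simp add: algebra_simps)
  qed (use e1 \<epsilon> \<eta> in auto)
qed

section \<open>Kepler motion in terms of the true anomaly\<close>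

lemma trig_double_arctan:
  "cos (2 * arctan x) = (1 - x\<^sup>2) / (1 + x\<^sup>2)" "sin (2 * arctan x) = 2 * x / (1 + x\<^sup>2)"
proof -
  have p: "1 + x\<^sup>2 > 0" using zero_le_power2[of x] by linarith
  show "cos (2 * arctan x) = (1 - x\<^sup>2) / (1 + x\<^sup>2)"
    using p unfolding cos_double sin_arctan cos_arctan
    by (simp add: power_divide diff_divide_distrib)
  show "sin (2 * arctan x) = 2 * x / (1 + x\<^sup>2)"
    using p unfolding sin_double sin_arctan cos_arctan by simp
qed

context
  fixes e :: real
begin

definition "semiminor = sqrt (1 - e\<^sup>2)"

text \<open>
With \<open>\<beta> = e / (1 + sqrt (1 - e\<^sup>2))\<close> the eccentric anomaly is
\<open>f - 2 arctan (\<beta> sin f / (1 + \<beta> cos f))\<close> as a function of the true anomaly \<open>f\<close>. Unlike the half-angle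
formula, this expression is smooth on the whole real line.
\<close>
definition "\<beta> = e / (1 + semiminor)"

definition "ecc_of_true f = f - 2 * arctan (\<beta> * sin f / (1 + \<beta> * cos f))"

definition "time_of_true f = ecc_of_true f - e * sin (ecc_of_true f)"

text \<open>
The argument \<open>3 t - 2 f\<close> of the \<open>3:2\<close> torque as a function of the true anomaly.
\<close>
definition "phase f = 3 * time_of_true f - 2 * f"

text \<open>
At \<open>v = pi / 4\<close> the \<open>3:2\<close> torque is \<open>cos (3 t - 2 f) / \<rho>\<^sup>3\<close>. A deviation of \<open>v\<close> by at most \<open>d / 2\<close>
lowers the cosine by at most \<open>d\<close>.
\<close>
definition "torque_minorant d t = (cos (3 * t - 2 * true_anomaly e t) - d) / orbital_radius e t ^ 3"

context
  assumes e: "0 \<le> e" "e < 1"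
begin

lemma semiminor: "0 < semiminor" "semiminor\<^sup>2 = 1 - e\<^sup>2"
proof -
  have "e\<^sup>2 < 1" using e by (simp add: power_less_one_iff abs_square_less_1)
  then show "0 < semiminor" "semiminor\<^sup>2 = 1 - e\<^sup>2" by (auto simp: semiminor_def)
qed

lemma beta: "0 \<le> \<beta>" "\<beta> < 1" "e * (1 + \<beta>\<^sup>2) = 2 * \<beta>" "semiminor * (1 + \<beta>\<^sup>2) = 1 - \<beta>\<^sup>2"
proof -
  show "0 \<le> \<beta>" using e semiminor by (simp add: \<beta>_def)
  show "\<beta> < 1" using e semiminor(1) by (simp add: \<beta>_def)
  have "\<beta>\<^sup>2 = ((1 - semiminor) * (1 + semiminor)) / (1 + semiminor)\<^sup>2"
    unfolding \<beta>_def power_divide using semiminor(2) by (simp add: power2_eq_square algebra_simps)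
  also have "\<dots> = (1 - semiminor) / (1 + semiminor)"
    using semiminor(1) by (simp add: power2_eq_square)
  finally have b: "\<beta>\<^sup>2 = (1 - semiminor) / (1 + semiminor)" .
  show "e * (1 + \<beta>\<^sup>2) = 2 * \<beta>" "semiminor * (1 + \<beta>\<^sup>2) = 1 - \<beta>\<^sup>2"
    using semiminor(1) by (unfold b) (simp_all add: \<beta>_def field_simps)
qed

lemma abs_mult_cos_le: "0 \<le> b \<Longrightarrow> \<bar>b * cos f\<bar> \<le> b" for b f :: real
  using mult_left_mono[OF abs_cos_le_one[of f], of b] by (simp add: abs_mult)

lemma cos_denominators_pos: "0 < 1 + \<beta> * cos f" "0 < 1 + e * cos f"
  using abs_mult_cos_le[of \<beta> f] abs_mult_cos_le[of e f] beta e by auto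

lemma arctan_denominator:
  "1 + (\<beta> * sin f / (1 + \<beta> * cos f))\<^sup>2 = (1 + \<beta>\<^sup>2) * (1 + e * cos f) / (1 + \<beta> * cos f)\<^sup>2"
proof -
  have "(1 + \<beta> * cos f)\<^sup>2 + (\<beta> * sin f)\<^sup>2 = (1 + \<beta>\<^sup>2) + 2 * \<beta> * cos f"
    using sin_cos_squared_add[of f] by algebra
  also have "\<dots> = (1 + \<beta>\<^sup>2) * (1 + e * cos f)"
    using beta(3) by algebra
  finally have "(1 + \<beta> * cos f)\<^sup>2 + (\<beta> * sin f)\<^sup>2 = (1 + \<beta>\<^sup>2) * (1 + e * cos f)" .
  then show ?thesis using cos_denominators_pos(1)[of f] by (simp add: power_divide field_simps)
qed

lemma trig_ecc_of_true:
  "cos (ecc_of_true f) = (cos f + e) / (1 + e * cos f)"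
  "sin (ecc_of_true f) = semiminor * sin f / (1 + e * cos f)"
proof -
  define c S D where "c = cos f" and "S = sin f" and "D = 1 + \<beta> * cos f"
  define x where "x = \<beta> * S / D"
  define N where "N = (1 + \<beta>\<^sup>2) * (1 + e * c)"
  have D: "D > 0" and ec: "1 + e * c > 0" using cos_denominators_pos by (auto simp: D_def c_def)
  have b2: "1 + \<beta>\<^sup>2 > 0" using zero_le_power2[of \<beta>] by linarith
  have N: "N > 0" using ec b2 by (simp add: N_def)
  have S2: "S\<^sup>2 = 1 - c\<^sup>2" by (simp add: S_def c_def sin_squared_eq)
  have Dc: "D = 1 + \<beta> * c" by (simp add: D_def c_def)
  have x1: "1 + x\<^sup>2 = N / D\<^sup>2"
    unfolding x_def N_def S_def c_def D_def by (rule arctan_denominator)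
  have x2: "1 - x\<^sup>2 = (D\<^sup>2 - (\<beta> * S)\<^sup>2) / D\<^sup>2"
    using D by (simp add: x_def power_divide diff_divide_distrib)
  have c2: "cos (2 * arctan x) = (D\<^sup>2 - (\<beta> * S)\<^sup>2) / N"
    unfolding trig_double_arctan x1 x2 using D by simp
  have s2: "sin (2 * arctan x) = 2 * \<beta> * S * D / N"
    unfolding trig_double_arctan x1 using D by (simp add: x_def power2_eq_square)
  have U: "ecc_of_true f = f - 2 * arctan x" by (simp add: ecc_of_true_def x_def S_def D_def)
  have "cos (ecc_of_true f) = (c * (D\<^sup>2 - (\<beta> * S)\<^sup>2) + S * (2 * \<beta> * S * D)) / N"
    unfolding U cos_diff c2 s2 by (simp add: c_def S_def add_divide_distrib)
  also have "c * (D\<^sup>2 - (\<beta> * S)\<^sup>2) + S * (2 * \<beta> * S * D) = (1 + \<beta>\<^sup>2) * (c + e)"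
    using S2 Dc beta(3) by algebra
  also have "\<dots> / N = (c + e) / (1 + e * c)" using b2 by (simp add: N_def)
  finally show "cos (ecc_of_true f) = (cos f + e) / (1 + e * cos f)" by (simp add: c_def)
  have "sin (ecc_of_true f) = (S * (D\<^sup>2 - (\<beta> * S)\<^sup>2) - c * (2 * \<beta> * S * D)) / N"
    unfolding U sin_diff c2 s2 c_def[symmetric] S_def[symmetric]
    by (simp only: diff_divide_distrib right_diff_distrib times_divide_eq_right)
  also have "S * (D\<^sup>2 - (\<beta> * S)\<^sup>2) - c * (2 * \<beta> * S * D) = (1 + \<beta>\<^sup>2) * (semiminor * S)"
    using S2 Dc beta(4) by algebra
  also have "\<dots> / N = semiminor * S / (1 + e * c)" using b2 by (simp add: N_def)
  finally show "sin (ecc_of_true f) = semiminor * sin f / (1 + e * cos f)" by (simp add: c_def S_def)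
qed

lemma ecc_of_true_deriv:
  "(ecc_of_true has_real_derivative semiminor / (1 + e * cos f)) (at f)"
proof -
  define c S D where "c = cos f" and "S = sin f" and "D = 1 + \<beta> * cos f"
  have D: "D > 0" and ec: "1 + e * c > 0" using cos_denominators_pos by (auto simp: D_def c_def)
  have b2: "1 + \<beta>\<^sup>2 > 0" using zero_le_power2[of \<beta>] by linarith
  have S2: "S * S = 1 - c * c" using sin_squared_eq[of f] by (simp add: S_def c_def power2_eq_square)
  have Dc: "D = 1 + \<beta> * c" by (simp add: D_def c_def)
  have "((\<lambda>f. \<beta> * sin f / (1 + \<beta> * cos f)) has_real_derivative
      (\<beta> * c * D - \<beta> * S * (\<beta> * - S)) / (D * D)) (at f)"
    using D unfolding c_def S_def D_def
    by (auto intro!: derivative_eq_intros)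
  moreover have "(\<beta> * c * D - \<beta> * S * (\<beta> * - S)) / (D * D) = \<beta> * (c + \<beta>) / D\<^sup>2"
  proof -
    have "\<beta> * c * D - \<beta> * S * (\<beta> * - S) = \<beta> * (c + \<beta>)" using S2 Dc by algebra
    then show ?thesis by (simp add: power2_eq_square)
  qed
  ultimately have "((\<lambda>f. \<beta> * sin f / (1 + \<beta> * cos f)) has_real_derivative \<beta> * (c + \<beta>) / D\<^sup>2) (at f)"
    by metis
  from DERIV_chain2[OF DERIV_arctan this]
  have "((\<lambda>f. arctan (\<beta> * sin f / (1 + \<beta> * cos f))) has_real_derivative
      inverse (1 + (\<beta> * sin f / (1 + \<beta> * cos f))\<^sup>2) * (\<beta> * (c + \<beta>) / D\<^sup>2)) (at f)" .
  then have "((\<lambda>f. arctan (\<beta> * sin f / (1 + \<beta> * cos f))) has_real_derivative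
      \<beta> * (c + \<beta>) / ((1 + \<beta>\<^sup>2) * (1 + e * c))) (at f)"
    unfolding arctan_denominator using D by (simp add: c_def D_def)
  then have "((\<lambda>f. f - 2 * arctan (\<beta> * sin f / (1 + \<beta> * cos f))) has_real_derivative
      1 - 2 * (\<beta> * (c + \<beta>) / ((1 + \<beta>\<^sup>2) * (1 + e * c)))) (at f)"
    by (intro DERIV_diff DERIV_cmult DERIV_ident)
  moreover have "1 - 2 * (\<beta> * (c + \<beta>) / ((1 + \<beta>\<^sup>2) * (1 + e * c))) = semiminor / (1 + e * c)"
  proof -
    have "(1 + \<beta>\<^sup>2) * (1 + e * c) - 2 * (\<beta> * (c + \<beta>)) = (1 + \<beta>\<^sup>2) * semiminor"
      using beta(3,4) by algebra
    then have "((1 + \<beta>\<^sup>2) * (1 + e * c) - 2 * (\<beta> * (c + \<beta>))) / ((1 + \<beta>\<^sup>2) * (1 + e * c))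
        = semiminor / (1 + e * c)" using b2 by simp
    then show ?thesis using b2 ec by (simp add: diff_divide_distrib)
  qed
  ultimately show ?thesis unfolding ecc_of_true_def[abs_def] c_def by metis
qed

lemma ecc_anomaly_time_of_true: "ecc_anomaly e (time_of_true f) = ecc_of_true f"
  using e by (intro ecc_anomaly_eqI) (auto simp: time_of_true_def)

lemma orbital_radius_time_of_true: "orbital_radius e (time_of_true f) = semiminor\<^sup>2 / (1 + e * cos f)"
  unfolding orbital_radius_def ecc_anomaly_time_of_true trig_ecc_of_true semiminor(2)
  using cos_denominators_pos(2)[of f] by (simp add: field_simps power2_eq_square)

lemma trig_true_anomaly_time_of_true:
  "cos (true_anomaly e (time_of_true f)) = cos f" "sin (true_anomaly e (time_of_true f)) = sin f"
proof -
  have p: "1 + e * cos f > 0" "semiminor\<^sup>2 > 0" using cos_denominators_pos semiminor(1) by auto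
  have "cos f + e - e * (1 + e * cos f) = semiminor\<^sup>2 * cos f"
    unfolding semiminor(2) by (simp add: power2_eq_square algebra_simps)
  moreover have "(cos f + e) / (1 + e * cos f) - e = (cos f + e - e * (1 + e * cos f)) / (1 + e * cos f)"
    using p by (simp add: diff_divide_distrib)
  ultimately have "(cos f + e) / (1 + e * cos f) - e = semiminor\<^sup>2 * cos f / (1 + e * cos f)" by simp
  then show "cos (true_anomaly e (time_of_true f)) = cos f"
    unfolding cos_true_anomaly[OF e] ecc_anomaly_time_of_true orbital_radius_time_of_true trig_ecc_of_true
    using p by simp
  show "sin (true_anomaly e (time_of_true f)) = sin f"
    unfolding sin_true_anomaly[OF e] ecc_anomaly_time_of_true orbital_radius_time_of_true trig_ecc_of_true
      semiminor_def[symmetric]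
    using p semiminor(1) by (simp add: power2_eq_square)
qed

text \<open>
Kepler's second law: the areal velocity \<open>\<rho>\<^sup>2 f' / 2\<close> is constant.
\<close>
lemma time_of_true_deriv:
  "(time_of_true has_real_derivative semiminor ^ 3 / (1 + e * cos f)\<^sup>2) (at f)"
proof -
  have p: "1 + e * cos f > 0" using cos_denominators_pos by auto
  have "(time_of_true has_real_derivative semiminor / (1 + e * cos f)
      - e * (cos (ecc_of_true f) * (semiminor / (1 + e * cos f)))) (at f)"
    unfolding time_of_true_def[abs_def]
    by (intro DERIV_diff DERIV_cmult DERIV_chain2[OF DERIV_sin] ecc_of_true_deriv)
  then have "(time_of_true has_real_derivative
      (1 - e * cos (ecc_of_true f)) * (semiminor / (1 + e * cos f))) (at f)"
    by (simp only: left_diff_distrib mult_1 mult.assoc)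
  moreover have "1 - e * cos (ecc_of_true f) = semiminor\<^sup>2 / (1 + e * cos f)"
    using orbital_radius_time_of_true[of f] by (simp add: orbital_radius_def ecc_anomaly_time_of_true)
  ultimately show ?thesis by (simp add: power2_eq_square power3_eq_cube)
qed

lemma time_of_true_0: "time_of_true 0 = 0" and time_of_true_pi: "time_of_true pi = pi"
  by (auto simp: time_of_true_def ecc_of_true_def)

lemma phase_deriv: "(phase has_real_derivative 3 * (semiminor ^ 3 / (1 + e * cos f)\<^sup>2) - 2) (at f)"
  unfolding phase_def[abs_def] by (auto intro!: derivative_eq_intros time_of_true_deriv)

lemma phase_0: "phase 0 = 0" and phase_pi: "phase pi = pi"
  by (auto simp: phase_def time_of_true_0 time_of_true_pi)

lemma phase_convex: "convex_on {0..pi} phase"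
proof (rule convex_on_realI[OF _ phase_deriv])
  fix x y :: real
  assume "x \<in> {0..pi}" "y \<in> {0..pi}" "x \<le> y"
  then have "cos y \<le> cos x" by (intro cos_monotone_0_pi_le) auto
  then have "1 + e * cos y \<le> 1 + e * cos x" using e by (simp add: mult_left_mono)
  then have "(1 + e * cos y)\<^sup>2 \<le> (1 + e * cos x)\<^sup>2"
    using cos_denominators_pos[of y] by (intro power_mono) auto
  then show "3 * (semiminor ^ 3 / (1 + e * cos x)\<^sup>2) - 2 \<le> 3 * (semiminor ^ 3 / (1 + e * cos y)\<^sup>2) - 2"
    using cos_denominators_pos[of x] cos_denominators_pos[of y] semiminor(1)
    by (intro diff_right_mono mult_left_mono divide_left_mono mult_pos_pos zero_less_power) auto
qed auto

lemma phase_half_pi_le: "phase (pi / 2) \<le> pi / 2 - 3 * e - 3 * e * semiminor"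
proof -
  have "e = sin (2 * arctan \<beta>)"
    unfolding trig_double_arctan using beta(3) by (simp add: eq_divide_eq add_nonneg_eq_0_iff)
  also have "\<dots> \<le> 2 * arctan \<beta>"
    using beta(1) by (intro sin_x_le_x) auto
  finally have "e \<le> 2 * arctan \<beta>" .
  then have "ecc_of_true (pi / 2) \<le> pi / 2 - e" by (simp add: ecc_of_true_def)
  moreover have "sin (ecc_of_true (pi / 2)) = semiminor" by (simp add: trig_ecc_of_true)
  ultimately show ?thesis by (simp add: phase_def time_of_true_def)
qed

lemma torque_minorant_eq:
  "torque_minorant d t = (cos (3 * t) * (2 * (cos (true_anomaly e t))\<^sup>2 - 1)
      + sin (3 * t) * (2 * sin (true_anomaly e t) * cos (true_anomaly e t)) - d) / orbital_radius e t ^ 3"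
  unfolding torque_minorant_def cos_diff by (simp add: cos_double_cos sin_double)

lemma torque_minorant_continuous: "continuous_on UNIV (torque_minorant d)"
  unfolding torque_minorant_eq[abs_def]
  using orbital_radius_pos[OF e]
  by (auto intro!: continuous_intros orbital_radius_continuous[OF e]
      trig_true_anomaly_continuous[OF e] simp: less_imp_neq[THEN not_sym])

lemma torque_minorant_shift: "torque_minorant d (t + 2 * pi) = torque_minorant d t"
proof -
  have "cos (3 * t + of_int 3 * (2 * pi)) = cos (3 * t)" "sin (3 * t + of_int 3 * (2 * pi)) = sin (3 * t)"
    by (rule int_periodic, simp)+
  then have "cos (3 * (t + 2 * pi)) = cos (3 * t)" "sin (3 * (t + 2 * pi)) = sin (3 * t)"
    by (simp_all add: algebra_simps)
  then show ?thesis
    using trig_true_anomaly_shift[OF e, of t 1] orbital_radius_shift[OF e, of t 1]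
    by (simp add: torque_minorant_eq)
qed

lemma torque_minorant_reflect: "torque_minorant d (2 * pi - t) = torque_minorant d t"
proof -
  have "cos (- (3 * t) + of_int 3 * (2 * pi)) = cos (- (3 * t))"
    "sin (- (3 * t) + of_int 3 * (2 * pi)) = sin (- (3 * t))"
    by (rule int_periodic, simp)+
  then have 1: "cos (3 * (2 * pi - t)) = cos (3 * t)" "sin (3 * (2 * pi - t)) = - sin (3 * t)"
    by (simp_all add: algebra_simps)
  have u: "cos (ecc_anomaly e (2 * pi - t)) = cos (ecc_anomaly e t)"
    "sin (ecc_anomaly e (2 * pi - t)) = - sin (ecc_anomaly e t)"
    unfolding ecc_anomaly_reflect[OF e] by (simp_all add: cos_diff sin_diff)
  then have r: "orbital_radius e (2 * pi - t) = orbital_radius e t" by (simp add: orbital_radius_def)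
  show ?thesis unfolding torque_minorant_eq cos_true_anomaly[OF e] sin_true_anomaly[OF e] 1 u r by simp
qed

text \<open>
Passing to the true anomaly turns the singular weight \<open>1 / \<rho>\<^sup>3\<close> into the trigonometric
polynomial \<open>1 + e cos f\<close>: two of the three powers of \<open>1 / \<rho>\<close> are absorbed by \<open>dt / df\<close>.
\<close>
lemma torque_minorant_time_of_true:
  "torque_minorant d (time_of_true f) * (semiminor ^ 3 / (1 + e * cos f)\<^sup>2)
     = (1 + e * cos f) * (cos (phase f) - d) / semiminor ^ 3"
proof -
  have p: "1 + e * cos f > 0" "semiminor > 0" using cos_denominators_pos semiminor(1) by auto
  have "cos (phase f) = cos (3 * time_of_true f) * (2 * (cos f)\<^sup>2 - 1)
      + sin (3 * time_of_true f) * (2 * sin f * cos f)"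
    unfolding phase_def cos_diff by (simp add: cos_double_cos sin_double)
  then have "torque_minorant d (time_of_true f) = (cos (phase f) - d) / (semiminor\<^sup>2 / (1 + e * cos f)) ^ 3"
    unfolding torque_minorant_eq trig_true_anomaly_time_of_true orbital_radius_time_of_true by simp
  moreover have "(semiminor\<^sup>2 / (1 + e * cos f)) ^ 3 = semiminor ^ 6 / (1 + e * cos f) ^ 3"
    by (simp add: power_divide flip: power_mult)
  moreover have "(x / (s ^ 6 / y ^ 3)) * (s ^ 3 / y\<^sup>2) = y * x / s ^ 3" if "s > 0" "y > 0" for s x y :: real
    using that by (simp add: field_simps power2_eq_square power3_eq_cube power_numeral_reduce)
  ultimately show ?thesis using p by metis
qed

text \<open>
The integrand is even about \<open>pi\<close> and has period \<open>2 pi\<close>.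
\<close>
lemma torque_minorant_integral_symmetric:
  assumes "\<And>t. (P has_real_derivative torque_minorant d t) (at t)" "P 0 = 0"
  shows "P (4 * pi) = 4 * P pi"
proof -
  have s: "((\<lambda>t. P (t + 2 * pi)) has_real_derivative torque_minorant d t) (at t)" for t
    using DERIV_shift[of P "torque_minorant d t" t "2 * pi"] assms(1)[of "t + 2 * pi"] torque_minorant_shift by simp
  have "P (2 * pi + 2 * pi) - P (0 + 2 * pi) = P (2 * pi) - P 0"
    by (rule diff_eq_of_derivs_eq[OF s assms(1)])
  moreover have r: "((\<lambda>t. - P (2 * pi - t)) has_real_derivative torque_minorant d t) (at t)" for t
    using torque_minorant_reflect[of d t] by (auto intro!: derivative_eq_intros DERIV_chain2[OF assms(1)])
  have "- P (2 * pi - pi) - - P (2 * pi - 0) = P pi - P 0"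
    by (rule diff_eq_of_derivs_eq[OF r assms(1)])
  ultimately show ?thesis using assms(2) by simp
qed

end

end

lemma cos_ge_cosI: "\<bar>a\<bar> \<le> b \<Longrightarrow> b \<le> pi \<Longrightarrow> cos b \<le> cos a" for a b :: real
  using cos_monotone_0_pi_le[of "\<bar>a\<bar>" b] by simp

lemma sin_cos_pi_eighth: "0.38 \<le> sin (pi / 8)" "0.92 \<le> cos (pi / 8)"
proof -
  have sq: "1.414 \<le> sqrt 2" "sqrt 2 \<le> 1.4143"
    by (rule real_le_rsqrt real_le_lsqrt; simp add: power2_eq_square)+
  have c: "sqrt 2 / 2 = 2 * (cos (pi / 8))\<^sup>2 - 1"
    using cos_double_cos[of "pi / 8"] cos_45 by simp
  have "0.92\<^sup>2 \<le> (cos (pi / 8))\<^sup>2" using c sq by (simp add: power2_eq_square)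
  then show "0.92 \<le> cos (pi / 8)" by (rule power2_le_imp_le) (auto intro!: cos_ge_zero)
  have "0.38\<^sup>2 \<le> (sin (pi / 8))\<^sup>2" unfolding sin_squared_eq using c sq by (simp add: power2_eq_square)
  then show "0.38 \<le> sin (pi / 8)" by (rule power2_le_imp_le) (auto intro!: sin_ge_zero)
qed

section \<open>The resonance of Mercury\<close>

context
  fixes e :: real
  assumes e: "0 \<le> e" "e < 1"
begin

text \<open>
The phase is convex on \<open>{0..pi}\<close>, so it lies below the broken line through \<open>(0, 0)\<close>,
\<open>(pi/2, pi/8)\<close> and \<open>(pi, pi)\<close>; and it lies above \<open>- f / 8\<close>. Hence its cosine is at least the cosine of the
broken line, which is integrated exactly against \<open>1 + e cos f\<close>; \<open>H1\<close> and \<open>H2\<close> are the primitives on the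
two halves. The assumption \<open>lower\<close> says that the derivative of the phase, which is smallest at 0, is
at least \<open>- 1 / 8\<close> there, and \<open>mid\<close> puts the phase at \<open>pi/2\<close> below \<open>pi/8\<close>. The value \<open>pi/8\<close> is chosen
because its sine and cosine are square roots and the first segment then has slope \<open>1/4\<close>.
\<close>
lemma phase_weight_integral:
  assumes lower: "15 / 8 * (1 + e)\<^sup>2 \<le> 3 * semiminor e ^ 3"
    and mid: "3 * pi / 8 \<le> 3 * e + 3 * e * semiminor e"
    and H: "\<And>f. (H has_real_derivative (1 + e * cos f) * cos (phase e f)) (at f)"
  shows "24 / 7 * sin (pi / 8) + 1024 / 660 * e * cos (pi / 8) \<le> H pi - H 0"
proof -
  have ge: "- f / 8 \<le> phase e f" if "0 \<le> f" "f \<le> pi" for f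
  proof -
    have "- f / 8 - - 0 / 8 \<le> phase e f - phase e 0"
    proof (rule DERIV_diff_le[OF that(1) _ phase_deriv[OF e]])
      fix x :: real
      show "((\<lambda>x. - x / 8) has_real_derivative - 1 / 8) (at x)"
        by (auto intro!: derivative_eq_intros)
      have p: "1 + e * cos x > 0" using cos_denominators_pos[OF e] by auto
      have "1 + e * cos x \<le> 1 + e" using e by (simp add: mult_left_le)
      then have "(1 + e * cos x)\<^sup>2 \<le> (1 + e)\<^sup>2" using p by (intro power_mono) auto
      then have "15 / 8 * (1 + e * cos x)\<^sup>2 \<le> 3 * semiminor e ^ 3" using lower by linarith
      then have "15 / 8 \<le> 3 * semiminor e ^ 3 / (1 + e * cos x)\<^sup>2" using p by (simp add: pos_le_divide_eq)
      then show "- 1 / 8 \<le> 3 * (semiminor e ^ 3 / (1 + e * cos x)\<^sup>2) - 2" by simp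
    qed
    then show ?thesis by (simp add: phase_0[OF e])
  qed
  have half: "phase e (pi / 2) \<le> pi / 8"
    using phase_half_pi_le[OF e] mid by simp
  have conv: "convex_on {0..pi / 2} (phase e)" "convex_on {pi / 2..pi} (phase e)"
    by (rule convex_on_subset[OF phase_convex[OF e]]; simp)+
  have first: "cos (f / 4) \<le> cos (phase e f)" if f: "0 \<le> f" "f \<le> pi / 2" for f
  proof (rule cos_ge_cosI)
    have "phase e f \<le> (phase e (pi / 2) - phase e 0) / (pi / 2 - 0) * (f - 0) + phase e 0"
      using f by (intro convex_onD_Icc'[OF conv(1)]) auto
    also have "\<dots> \<le> (pi / 8) / (pi / 2) * f"
    proof -
      have "(phase e (pi / 2) - phase e 0) / (pi / 2 - 0) \<le> (pi / 8) / (pi / 2)"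
        using half by (simp only: phase_0[OF e] diff_0_right) (rule divide_right_mono, auto)
      from mult_right_mono[OF this f(1)] show ?thesis by (simp only: phase_0[OF e] diff_0_right add_0_right)
    qed
    finally have "phase e f \<le> f / 4" by simp
    then show "\<bar>phase e f\<bar> \<le> f / 4" using ge[of f] f by auto
  qed (use f in auto)
  have second: "cos (7 / 4 * f - 3 * pi / 4) \<le> cos (phase e f)" if f: "pi / 2 \<le> f" "f \<le> pi" for f
  proof (rule cos_ge_cosI)
    have "phase e f \<le> (phase e (pi / 2) - phase e pi) / (pi - pi / 2) * (pi - f) + phase e pi"
      using f by (intro convex_onD_Icc''[OF conv(2)]) auto
    also have "\<dots> \<le> (pi / 8 - pi) / (pi - pi / 2) * (pi - f) + pi"
    proof -
      have "(phase e (pi / 2) - phase e pi) / (pi - pi / 2) \<le> (pi / 8 - pi) / (pi - pi / 2)"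
        using half by (simp only: phase_pi[OF e]) (rule divide_right_mono, auto)
      moreover have "0 \<le> pi - f" using f by simp
      ultimately show ?thesis unfolding phase_pi[OF e] by (intro add_right_mono mult_right_mono)
    qed
    also have "(pi / 8 - pi) / (pi - pi / 2) = - 7 / 4" by (simp add: field_simps)
    finally have "phase e f \<le> - 7 / 4 * (pi - f) + pi" .
    also have "\<dots> = 7 / 4 * f - 3 * pi / 4" by (simp add: field_simps)
    finally have "phase e f \<le> 7 / 4 * f - 3 * pi / 4" .
    then show "\<bar>phase e f\<bar> \<le> 7 / 4 * f - 3 * pi / 4" using ge[of f] f by auto
  qed (use f in auto)
  have weight: "0 \<le> 1 + e * cos f" for f using cos_denominators_pos(2)[OF e, of f] by simp
  define H1 where "H1 f = 4 * sin (f / 4) + e / 2 * (4 / 5 * sin (5 * f / 4) + 4 / 3 * sin (3 * f / 4))" for f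
  define H2 where "H2 f = 4 / 7 * sin (7 / 4 * f - 3 * pi / 4)
    + e / 2 * (4 / 11 * sin (11 / 4 * f - 3 * pi / 4) - 4 / 3 * sin (3 * pi / 4 - 3 / 4 * f))" for f
  have "H1 (pi / 2) - H1 0 \<le> H (pi / 2) - H 0"
  proof (rule DERIV_diff_le[OF _ _ H])
    fix f :: real assume f: "0 \<le> f" "f \<le> pi / 2"
    have "cos f * cos (f / 4) = (cos (3 * f / 4) + cos (5 * f / 4)) / 2"
      unfolding cos_times_cos by (simp add: algebra_simps)
    then have "(1 + e * cos f) * cos (f / 4) = cos (f / 4) + e / 2 * (cos (5 * f / 4) + cos (3 * f / 4))"
      by (simp only: distrib_right mult.assoc) (simp add: algebra_simps)
    moreover have "(H1 has_real_derivative cos (f / 4) + e / 2 * (cos (5 * f / 4) + cos (3 * f / 4))) (at f)"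
      unfolding H1_def[abs_def] by (auto intro!: derivative_eq_intros)
    ultimately show "(H1 has_real_derivative (1 + e * cos f) * cos (f / 4)) (at f)"
      by simp
    show "(1 + e * cos f) * cos (f / 4) \<le> (1 + e * cos f) * cos (phase e f)"
      by (intro mult_left_mono first weight f)
  qed auto
  moreover have "H2 pi - H2 (pi / 2) \<le> H pi - H (pi / 2)"
  proof (rule DERIV_diff_le[OF _ _ H])
    fix f :: real assume f: "pi / 2 \<le> f" "f \<le> pi"
    define L where "L = 7 / 4 * f - 3 * pi / 4"
    have "cos f * cos L = (cos (f - L) + cos (f + L)) / 2" by (rule cos_times_cos)
    moreover have "f - L = 3 * pi / 4 - 3 / 4 * f" "f + L = 11 / 4 * f - 3 * pi / 4"
      by (simp_all add: L_def)
    ultimately have "(1 + e * cos f) * cos L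
        = cos L + e / 2 * (cos (11 / 4 * f - 3 * pi / 4) + cos (3 * pi / 4 - 3 / 4 * f))"
      by (simp only: distrib_right mult.assoc) (simp add: algebra_simps)
    moreover have "(H2 has_real_derivative
        cos L + e / 2 * (cos (11 / 4 * f - 3 * pi / 4) + cos (3 * pi / 4 - 3 / 4 * f))) (at f)"
      unfolding H2_def[abs_def] L_def by (auto intro!: derivative_eq_intros)
    ultimately show "(H2 has_real_derivative (1 + e * cos f) * cos (7 / 4 * f - 3 * pi / 4)) (at f)"
      unfolding L_def by simp
    show "(1 + e * cos f) * cos (7 / 4 * f - 3 * pi / 4) \<le> (1 + e * cos f) * cos (phase e f)"
      by (intro mult_left_mono second weight f)
  qed auto
  moreover have "H1 0 = 0" "H2 pi = 0" by (auto simp: H1_def H2_def)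
  moreover have c: "sin (5 * pi / 8) = cos (pi / 8)" "sin (3 * pi / 8) = cos (pi / 8)"
    using sin_cos_eq[of "5 * pi / 8"] sin_cos_eq[of "3 * pi / 8"] cos_minus[of "pi / 8"] by simp_all
  have "H1 (pi / 2) = 4 * sin (pi / 8) + e / 2 * (32 / 15 * cos (pi / 8))"
    using c by (simp add: H1_def)
  moreover have "H2 (pi / 2) = 4 / 7 * sin (pi / 8) + e / 2 * (- (32 / 33) * cos (pi / 8))"
    using c by (simp add: H2_def)
  ultimately show ?thesis by (simp add: algebra_simps)
qed

lemma torque_minorant_integral_ge:
  assumes lower: "15 / 8 * (1 + e)\<^sup>2 \<le> 3 * semiminor e ^ 3"
    and mid: "3 * pi / 8 \<le> 3 * e + 3 * e * semiminor e"
    and P: "\<And>t. (P has_real_derivative torque_minorant e d t) (at t)" "P 0 = 0"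
  shows "24 / 7 * sin (pi / 8) + 1024 / 660 * e * cos (pi / 8) - d * pi \<le> semiminor e ^ 3 * P pi"
proof -
  define s where "s = semiminor e"
  have s: "s > 0" using semiminor[OF e] by (simp add: s_def)
  define H where "H f = s ^ 3 * P (time_of_true e f) + d * (f + e * sin f)" for f
  have "(H has_real_derivative (1 + e * cos f) * cos (phase e f)) (at f)" for f
  proof -
    have "((\<lambda>f. P (time_of_true e f)) has_real_derivative
        torque_minorant e d (time_of_true e f) * (semiminor e ^ 3 / (1 + e * cos f)\<^sup>2)) (at f)"
      by (rule DERIV_chain2[OF P(1) time_of_true_deriv[OF e]])
    then have "((\<lambda>f. P (time_of_true e f)) has_real_derivative
        (1 + e * cos f) * (cos (phase e f) - d) / s ^ 3) (at f)"
      unfolding torque_minorant_time_of_true[OF e] s_def .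
    from DERIV_cmult[OF this, of "s ^ 3"]
    have "((\<lambda>f. s ^ 3 * P (time_of_true e f)) has_real_derivative
        (1 + e * cos f) * (cos (phase e f) - d)) (at f)" using s by simp
    moreover have "((\<lambda>f. d * (f + e * sin f)) has_real_derivative d * (1 + e * cos f)) (at f)"
      by (auto intro!: derivative_eq_intros)
    ultimately show ?thesis
      unfolding H_def[abs_def] by (rule DERIV_cong[OF DERIV_add]) (simp add: algebra_simps)
  qed
  from phase_weight_integral[OF lower mid this]
  show ?thesis by (simp add: H_def time_of_true_0[OF e] time_of_true_pi[OF e] P(2) s_def algebra_simps)
qed

end

text \<open>
The fixed points deviate by at most \<open>\<delta> = 0.0243\<close>. After this loss, the integral of the torque
over half a revolution is still at least 1.53 (its value without the loss is about 2.05), while 1.248 suffices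
to balance the drift \<open>\<eta> (3/2 - \<nu>)\<close> at \<open>\<eta> = 0.001\<close>.
\<close>
lemma mercury_resonance:
  assumes \<eta>: "0 \<le> \<eta>" "\<eta> \<le> 0.001"
  shows "\<exists>x. spin_orbit_resonance 3 2 0.2056 0.00061470369 1.255835458 \<eta> x"
proof -
  define e :: real where "e = 0.2056"
  define \<epsilon> :: real where "\<epsilon> = 0.00061470369"
  define \<nu> :: real where "\<nu> = 1.255835458"
  define \<delta> :: real where "\<delta> = 0.0243"
  have e: "0 \<le> e" "e < 1" by (auto simp: e_def)
  have \<epsilon>: "0 \<le> \<epsilon>" by (simp add: \<epsilon>_def)
  define s where "s = semiminor e"
  have s0: "s > 0" "s\<^sup>2 = 0.95772864"
    using semiminor[OF e] by (auto simp: s_def e_def power2_eq_square)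
  have s: "0.978 \<le> s" "s \<le> 0.979"
    by (rule power2_le_imp_le; use s0 in \<open>simp add: power2_eq_square\<close>)+
  have "s ^ 3 = s\<^sup>2 * s" by (simp add: power2_eq_square power3_eq_cube)
  then have s3: "0.9366 \<le> s ^ 3" "s ^ 3 \<le> 0.9377" using s unfolding s0(2) by simp_all
  have \<eta>pi: "\<eta> * pi \<le> 0.001 * 3.1416" using \<eta> pi_approx by (intro mult_mono) auto
  have pi2: "pi * pi \<le> 3.1416 * 3.1416" using pi_approx by (intro mult_mono) auto
  define P where "P = prim (torque_minorant e (2 * \<delta>))"
  have P: "(P has_real_derivative torque_minorant e (2 * \<delta>) t) (at t)" "P 0 = 0" for t
    unfolding P_def by (rule prim_deriv[OF torque_minorant_continuous[OF e]] prim_0[OF torque_minorant_continuous[OF e]])+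
  have P4: "P (4 * pi) = 4 * P pi" by (rule torque_minorant_integral_symmetric[OF e P])
  have "24 / 7 * sin (pi / 8) + 1024 / 660 * e * cos (pi / 8) - 2 * \<delta> * pi \<le> s ^ 3 * P pi"
    unfolding s_def
  proof (rule torque_minorant_integral_ge[OF e _ _ P])
    show "15 / 8 * (1 + e)\<^sup>2 \<le> 3 * semiminor e ^ 3"
      using s3 by (simp add: s_def e_def power2_eq_square)
    show "3 * pi / 8 \<le> 3 * e + 3 * e * semiminor e"
      using s pi_approx by (simp add: s_def e_def)
  qed
  moreover have "1.44 \<le> 24 / 7 * sin (pi / 8) + 1024 / 660 * e * cos (pi / 8) - 2 * \<delta> * pi"
    using sin_cos_pi_eighth pi_approx by (simp add: e_def \<delta>_def)
  ultimately have sP: "1.44 \<le> s ^ 3 * P pi" by linarith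
  have Ppi: "1.53 \<le> P pi"
  proof (rule ccontr)
    assume "\<not> 1.53 \<le> P pi"
    then have "s ^ 3 * P pi \<le> s ^ 3 * 1.53" using s0(1) by (intro mult_left_mono) auto
    also have "\<dots> \<le> 0.9377 * 1.53" using s3 by (intro mult_right_mono) auto
    finally show False using sP by simp
  qed
  define T where "T = 2 * pi * real_of_int 2"
  have T: "T = 4 * pi" by (simp add: T_def)
  have balance: "\<eta> * (3 / 2 - \<nu>) * T \<le> \<epsilon> * P T"
  proof -
    have "\<eta> * (3 / 2 - \<nu>) * pi = \<eta> * pi * 0.244164542" by (simp add: \<nu>_def)
    also have "\<dots> \<le> 0.001 * 3.1416 * 0.244164542" using \<eta>pi by (intro mult_right_mono) auto
    also have "\<dots> \<le> \<epsilon> * 1.53" by (simp add: \<epsilon>_def)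
    also have "\<dots> \<le> \<epsilon> * P pi" using Ppi \<epsilon> by (intro mult_left_mono) auto
    finally show ?thesis unfolding T P4 by simp
  qed
  have torque: "torque_minorant e (2 * \<delta>) t \<le> cos (3 * t - 2 * true_anomaly e t + 2 * w) / orbital_radius e t ^ 3"
    if "\<bar>w\<bar> \<le> \<delta>" for t w
    unfolding torque_minorant_def
  proof (rule divide_right_mono)
    show "cos (3 * t - 2 * true_anomaly e t) - 2 * \<delta> \<le> cos (3 * t - 2 * true_anomaly e t + 2 * w)"
      using cos_dist_le[of "3 * t - 2 * true_anomaly e t" "3 * t - 2 * true_anomaly e t + 2 * w"] that
      by linarith
    show "0 \<le> orbital_radius e t ^ 3" using orbital_radius_pos[OF e, of t] by simp
  qed
  define m where "m = \<epsilon> * (1 / (1 - e) ^ 3)"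
  have m: "m \<le> 0.0012262" "0 \<le> m"
    by (simp_all add: m_def \<epsilon>_def e_def power3_eq_cube)
  have mp: "m * (pi * pi) \<le> 0.0012262 * (3.1416 * 3.1416)"
    by (rule mult_mono[OF m(1) pi2]) auto
  have "\<exists>x. spin_orbit_resonance 3 2 e \<epsilon> \<nu> \<eta> x"
  proof (rule resonance_criterion[where e = e and \<epsilon> = \<epsilon> and \<delta> = \<delta> and p = 3 and q = 2, folded T_def m_def])
    have "T / 4 * (m * T + 2 * \<eta>) = 4 * (m * (pi * pi)) + 2 * (\<eta> * pi)"
      unfolding T by (simp add: algebra_simps)
    also have "\<dots> < 1" using mp \<eta>pi by simp
    finally show "T / 4 * (m * T + 2 * \<eta>) < 1" .
    have "m * T\<^sup>2 / 8 = 2 * (m * (pi * pi))"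
      unfolding T by (simp add: power2_eq_square)
    also have "\<dots> \<le> \<delta> * (1 - \<eta> * pi)" using mp \<eta>pi by (simp add: \<delta>_def)
    finally show "m * T\<^sup>2 / 8 \<le> \<delta> * (1 - \<eta> * T / 4)" by (simp add: T)
  next
    fix v G
    assume v: "\<And>t. \<bar>v t - (- pi / 4)\<bar> \<le> \<delta>"
      and G: "\<And>t. (G has_real_derivative resonant_torque e (of_int 3 / of_int 2) t (v t)) (at t)"
    have "P T - P 0 \<le> - G T - (- G 0)"
    proof (rule DERIV_diff_le[OF _ P(1) DERIV_minus[OF G]])
      fix t :: real
      have "2 * (v t + of_int 3 / of_int 2 * t) - 2 * true_anomaly e t
          = (3 * t - 2 * true_anomaly e t + 2 * (v t - (- pi / 4))) - pi / 2" by (simp add: algebra_simps)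
      then have "- resonant_torque e (of_int 3 / of_int 2) t (v t)
          = cos (3 * t - 2 * true_anomaly e t + 2 * (v t - (- pi / 4))) / orbital_radius e t ^ 3"
        unfolding resonant_torque_def by (simp only: sin_diff[of _ "pi / 2"]) simp
      then show "torque_minorant e (2 * \<delta>) t \<le> - resonant_torque e (of_int 3 / of_int 2) t (v t)"
        using torque[OF v, of t t] by simp
    qed (simp add: T)
    then have "\<epsilon> * (G T - G 0) \<le> \<epsilon> * (- P T)" using \<epsilon> P(2) by (intro mult_left_mono) auto
    then show "\<epsilon> * (G T - G 0) + \<eta> * (of_int 3 / of_int 2 - \<nu>) * T \<le> 0" using balance by simp
  next
    fix v G
    assume v: "\<And>t. \<bar>v t - pi / 4\<bar> \<le> \<delta>"
      and G: "\<And>t. (G has_real_derivative resonant_torque e (of_int 3 / of_int 2) t (v t)) (at t)"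
    have "P T - P 0 \<le> G T - G 0"
    proof (rule DERIV_diff_le[OF _ P(1) G])
      fix t :: real
      have "2 * (v t + of_int 3 / of_int 2 * t) - 2 * true_anomaly e t
          = (3 * t - 2 * true_anomaly e t + 2 * (v t - pi / 4)) + pi / 2" by (simp add: algebra_simps)
      then have "resonant_torque e (of_int 3 / of_int 2) t (v t)
          = cos (3 * t - 2 * true_anomaly e t + 2 * (v t - pi / 4)) / orbital_radius e t ^ 3"
        unfolding resonant_torque_def by (simp only: sin_add[of _ "pi / 2"]) simp
      then show "torque_minorant e (2 * \<delta>) t \<le> resonant_torque e (of_int 3 / of_int 2) t (v t)"
        using torque[OF v, of t t] by simp
    qed (simp add: T)
    then have "0 \<le> G T - G 0" using P(2) P4 Ppi by (simp add: T)
    then show "0 \<le> \<epsilon> * (G T - G 0) + \<eta> * (of_int 3 / of_int 2 - \<nu>) * T"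
      using \<epsilon> \<eta> by (intro add_nonneg_nonneg mult_nonneg_nonneg) (auto simp: \<nu>_def T)
  qed (use e \<epsilon> \<eta> in auto)
  then show ?thesis by (simp only: e_def \<epsilon>_def \<nu>_def)
qed

theorem mainTheorem1:
  shows
    "(\<forall>(e, \<epsilon>, \<nu>) \<in> {
          (0.0549, 0.00248454179, 1.018088056),      \<comment> \<open>Moon\<close>
          (0.0041, 0.00863266715, 1.00010086),       \<comment> \<open>Io\<close>
          (0.0094, 0.00096104552, 1.000530163),      \<comment> \<open>Europa\<close>
          (0.0011, 0.0019382783, 1.00000726),        \<comment> \<open>Ganymede\<close>
          (0.0074, 0.00186698679, 1.000328561),      \<comment> \<open>Callisto\<close>
          (0.0193, 0.08966019091, 1.002234993),      \<comment> \<open>Mimas\<close>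
          (0.0047, 0.03540026218, 1.00013254),       \<comment> \<open>Enceladus\<close>
          (0.0001, 0.03293212897, 1.00000006),       \<comment> \<open>Tethys\<close>
          (0.0022, 0.00853478156, 1.00002904),       \<comment> \<open>Dione\<close>
          (0.001, 0.0098127957, 1.000006),           \<comment> \<open>Rhea\<close>
          (0.0288, 0.00017882901, 1.00497691),       \<comment> \<open>Titan\<close>
          (0.0283, 0.011662022156, 1.004805592),     \<comment> \<open>Iapetus\<close>
          (0.0012, 0.012162311957, 1.00000864),      \<comment> \<open>Ariel\<close>
          (0.0039, 0.01436601227, 1.00009126),       \<comment> \<open>Umbriel\<close>
          (0.0011, 0.00684493838, 1.00000726),       \<comment> \<open>Titania\<close>
          (0.0014, 0.01024416739, 1.00001176),       \<comment> \<open>Oberon\<close>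
          (0.0013, 0.04869051956, 1.00001014),       \<comment> \<open>Miranda\<close>
          (0.0022, 0.00695821306, 1.00002904)        \<comment> \<open>Charon\<close>}.
        \<forall>\<eta>::real. 0 \<le> \<eta> \<and> \<eta> \<le> 0.008 \<longrightarrow> (\<exists>x. spin_orbit_resonance 1 1 e \<epsilon> \<nu> \<eta> x)) \<and>
     (\<forall>\<eta>::real. 0 \<le> \<eta> \<and> \<eta> \<le> 0.001 \<longrightarrow>
        (\<exists>x. spin_orbit_resonance 3 2 0.2056 0.00061470369 1.255835458 \<eta> x))"
proof (rule conjI, goal_cases)
  case 1
  show ?case
    unfolding ball_simps split_conv simp_thms
    by (intro conjI allI impI; rule synchronous_resonance; simp add: power3_eq_cube)
next
  case 2
  show ?case using mercury_resonance by blast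
qed

end
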